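(* Let $d\ge4$ and let $L=-\sum_{i=1}^d\frac{\partial^2}{\partial x_i^2}$ be the operator in $L^2(\mathbb{R}^d)$ with domain $C_c^\infty(\mathbb{R}^d\setminus\{0\})$. Then the closure $\overline{L}$ of $L$ is self-adjoint.
   Context: The closure $\overline{L}$ is the operator closure of the symmetric operator $L$ in the complex Hilbert space $L^2(\mathbb{R}^d)$. *)

theory Defs
  imports "HOL-Analysis.Analysis"
begin

section \<open>The complex Hilbert space of square-integrable functions\<close>

definition square_integrable :: "('a::euclidean_space \<Rightarrow> complex) \<Rightarrow> bool" where
  "square_integrable f \<longleftrightarrow>
     f \<in> borel_measurable lborel \<and> integrable lborel (\<lambda>x. (cmod (f x))\<^sup>2)"

lemma square_integrable_zero: "square_integrable (\<lambda>x. 0)"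
  by (simp add: square_integrable_def)

lemma square_integrable_cmult:
  "square_integrable f \<Longrightarrow> square_integrable (\<lambda>x. c * f x)"
  by (auto simp: square_integrable_def norm_mult power_mult_distrib)

lemma square_integrable_add:
  assumes "square_integrable f" "square_integrable g"
  shows "square_integrable (\<lambda>x. f x + g x)"
proof -
  have [measurable]: "f \<in> borel_measurable lborel" "g \<in> borel_measurable lborel"
    using assms by (simp_all add: square_integrable_def)
  have "integrable lborel (\<lambda>x. (cmod (f x + g x))\<^sup>2)"
  proof (rule Bochner_Integration.integrable_bound)
    show "integrable lborel (\<lambda>x. 2 * (cmod (f x))\<^sup>2 + 2 * (cmod (g x))\<^sup>2)"
      using assms by (simp add: square_integrable_def)
    show "(\<lambda>x. (cmod (f x + g x))\<^sup>2) \<in> borel_measurable lborel"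
      by measurable
    have "(cmod (f x + g x))\<^sup>2 \<le> 2 * (cmod (f x))\<^sup>2 + 2 * (cmod (g x))\<^sup>2" for x
    proof -
      have "(cmod (f x + g x))\<^sup>2 \<le> (cmod (f x) + cmod (g x))\<^sup>2"
        by (intro power_mono norm_triangle_ineq norm_ge_zero)
      also have "\<dots> \<le> 2 * (cmod (f x))\<^sup>2 + 2 * (cmod (g x))\<^sup>2"
        using sum_squares_bound[of "cmod (f x)" "cmod (g x)"] by (simp add: power2_sum)
      finally show ?thesis .
    qed
    then show "AE x in lborel. norm ((cmod (f x + g x))\<^sup>2)
        \<le> norm (2 * (cmod (f x))\<^sup>2 + 2 * (cmod (g x))\<^sup>2)"
      by simp
  qed
  then show ?thesis
    by (simp add: square_integrable_def)
qed

lemma square_integrable_uminus: "square_integrable f \<Longrightarrow> square_integrable (\<lambda>x. - f x)"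
  using square_integrable_cmult[of f "-1"] by simp

lemma square_integrable_diff:
  "square_integrable f \<Longrightarrow> square_integrable g \<Longrightarrow> square_integrable (\<lambda>x. f x - g x)"
  using square_integrable_add[of f "\<lambda>x. - g x"] square_integrable_uminus[of g] by simp

lemma square_integrable_scaleR:
  "square_integrable f \<Longrightarrow> square_integrable (\<lambda>x. r *\<^sub>R f x)"
  using square_integrable_cmult[of f "of_real r"] by (simp add: scaleR_conv_of_real)

lemma borel_measurable_mult_cnj [measurable]:
  assumes "f \<in> borel_measurable M" "g \<in> borel_measurable M"
  shows "(\<lambda>x. f x * cnj (g x)) \<in> borel_measurable M"
proof -
  have "(\<lambda>x. cnj (g x)) \<in> borel_measurable M"
    using assms(2) by (rule borel_measurable_continuous_on[rotated]) (intro continuous_intros)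
  then show ?thesis
    using assms(1) by (rule borel_measurable_times[rotated])
qed

lemma integrable_mult_cnj:
  assumes "square_integrable f" "square_integrable g"
  shows "integrable lborel (\<lambda>x. f x * cnj (g x))"
proof (rule Bochner_Integration.integrable_bound)
  show "integrable lborel (\<lambda>x. (cmod (f x))\<^sup>2 + (cmod (g x))\<^sup>2)"
    using assms by (simp add: square_integrable_def)
  show "(\<lambda>x. f x * cnj (g x)) \<in> borel_measurable lborel"
    by (rule borel_measurable_mult_cnj) (use assms in \<open>simp_all add: square_integrable_def\<close>)
  have "norm (f x * cnj (g x)) \<le> norm ((cmod (f x))\<^sup>2 + (cmod (g x))\<^sup>2)" for x
  proof -
    have "2 * (cmod (f x) * cmod (g x)) \<le> (cmod (f x))\<^sup>2 + (cmod (g x))\<^sup>2"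
      using sum_squares_bound[of "cmod (f x)" "cmod (g x)"] by (simp add: mult.assoc)
    moreover have "0 \<le> cmod (f x) * cmod (g x)" by simp
    ultimately have "cmod (f x) * cmod (g x) \<le> (cmod (f x))\<^sup>2 + (cmod (g x))\<^sup>2"
      by linarith
    then show ?thesis by (simp add: norm_mult)
  qed
  then show "AE x in lborel. norm (f x * cnj (g x)) \<le> norm ((cmod (f x))\<^sup>2 + (cmod (g x))\<^sup>2)"
    by simp
qed

definition L2_eq :: "('a::euclidean_space \<Rightarrow> complex) \<Rightarrow> ('a \<Rightarrow> complex) \<Rightarrow> bool" where
  "L2_eq f g \<longleftrightarrow> square_integrable f \<and> square_integrable g \<and> (AE x in lborel. f x = g x)"

lemma part_equivp_L2_eq: "part_equivp (L2_eq :: ('a::euclidean_space \<Rightarrow> complex) \<Rightarrow> _)"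
proof (rule part_equivpI)
  show "\<exists>f. L2_eq f (f :: 'a \<Rightarrow> complex)"
    using square_integrable_zero by (auto simp: L2_eq_def)
  show "symp (L2_eq :: ('a \<Rightarrow> complex) \<Rightarrow> _)"
    by (auto simp: symp_def L2_eq_def elim: eventually_mono)
  show "transp (L2_eq :: ('a \<Rightarrow> complex) \<Rightarrow> _)"
    unfolding transp_def L2_eq_def by (auto elim: eventually_elim2)
qed

text \<open>Every Lebesgue measurable function agrees almost everywhere with a Borel function, so Borel
  representatives give the usual space.\<close>

quotient_type (overloaded) 'a L2 = "'a::euclidean_space \<Rightarrow> complex" / partial: L2_eq
  by (rule part_equivp_L2_eq)

lift_definition cinner :: "'a::euclidean_space L2 \<Rightarrow> 'a L2 \<Rightarrow> complex"
  is "\<lambda>f g. \<integral>x. f x * cnj (g x) \<partial>lborel"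
proof -
  fix f f' g g' :: "'a \<Rightarrow> complex"
  assume f: "L2_eq f f'" and g: "L2_eq g g'"
  then have [measurable]: "f \<in> borel_measurable lborel" "f' \<in> borel_measurable lborel"
    "g \<in> borel_measurable lborel" "g' \<in> borel_measurable lborel"
    by (auto simp: L2_eq_def square_integrable_def)
  have "AE x in lborel. f x = f' x" "AE x in lborel. g x = g' x"
    using f g by (auto simp: L2_eq_def)
  then have "AE x in lborel. f x * cnj (g x) = f' x * cnj (g' x)"
    by eventually_elim simp
  then show "(\<integral>x. f x * cnj (g x) \<partial>lborel) = (\<integral>x. f' x * cnj (g' x) \<partial>lborel)"
    by (intro integral_cong_AE borel_measurable_mult_cnj) auto
qed

lift_definition cscale :: "complex \<Rightarrow> 'a::euclidean_space L2 \<Rightarrow> 'a L2"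
  is "\<lambda>c f x. c * f x"
  by (auto simp: L2_eq_def intro: square_integrable_cmult elim: eventually_mono)

instantiation L2 :: (euclidean_space) real_vector
begin

lift_definition zero_L2 :: "'a L2" is "\<lambda>x. 0"
  by (simp add: L2_eq_def square_integrable_zero)

lift_definition plus_L2 :: "'a L2 \<Rightarrow> 'a L2 \<Rightarrow> 'a L2" is "\<lambda>f g x. f x + g x"
  unfolding L2_eq_def by (auto intro: square_integrable_add elim: eventually_elim2)

lift_definition uminus_L2 :: "'a L2 \<Rightarrow> 'a L2" is "\<lambda>f x. - f x"
  unfolding L2_eq_def by (auto intro: square_integrable_uminus elim: eventually_mono)

lift_definition minus_L2 :: "'a L2 \<Rightarrow> 'a L2 \<Rightarrow> 'a L2" is "\<lambda>f g x. f x - g x"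
  unfolding L2_eq_def by (auto intro: square_integrable_diff elim: eventually_elim2)

lift_definition scaleR_L2 :: "real \<Rightarrow> 'a L2 \<Rightarrow> 'a L2" is "\<lambda>r f x. r *\<^sub>R f x"
  unfolding L2_eq_def by (auto intro: square_integrable_scaleR elim: eventually_mono)

instance
  by (standard; transfer)
    (auto simp: L2_eq_def algebra_simps
      intro: square_integrable_add square_integrable_diff square_integrable_scaleR
        square_integrable_uminus square_integrable_zero)

end

lemma cinner_commute: "cinner u v = cnj (cinner v u)"
  by transfer (simp add: mult.commute flip: Bochner_Integration.integral_cnj)

lemma cinner_add_left: "cinner (u + v) w = cinner u w + cinner v w"
  by transfer (simp add: L2_eq_def integrable_mult_cnj distrib_right)

lemma cinner_cscale_left: "cinner (cscale c u) v = c * cinner u v"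
  by transfer (simp add: mult.assoc)

lemma scaleR_L2_conv_cscale: "r *\<^sub>R u = cscale (of_real r) u"
  by transfer (auto simp: L2_eq_def scaleR_conv_of_real intro: square_integrable_cmult)

lemma cinner_self:
  fixes u :: "'a::euclidean_space L2"
  shows "cinner u u = of_real (Re (cinner u u))" "0 \<le> Re (cinner u u)"
    "Re (cinner u u) = 0 \<longleftrightarrow> u = 0"
proof -
  show "cinner u u = of_real (Re (cinner u u))"
    by transfer (simp flip: complex_norm_square of_real_power)
  show "0 \<le> Re (cinner u u)"
    by transfer (simp flip: complex_norm_square of_real_power)
  show "Re (cinner u u) = 0 \<longleftrightarrow> u = 0"
  proof transfer
    fix f :: "'a \<Rightarrow> complex"
    assume f: "L2_eq f f"
    have "Re (\<integral>x. f x * cnj (f x) \<partial>lborel) = (\<integral>x. (cmod (f x))\<^sup>2 \<partial>lborel)"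
      by (simp flip: complex_norm_square of_real_power)
    moreover have "(\<integral>x. (cmod (f x))\<^sup>2 \<partial>lborel) = 0 \<longleftrightarrow> (AE x in lborel. (cmod (f x))\<^sup>2 = 0)"
      using f by (intro integral_nonneg_eq_0_iff_AE) (auto simp: L2_eq_def square_integrable_def)
    ultimately show "Re (\<integral>x. f x * cnj (f x) \<partial>lborel) = 0 \<longleftrightarrow> L2_eq f (\<lambda>x. 0)"
      using f by (simp add: L2_eq_def square_integrable_zero)
  qed
qed

text \<open>The topology of \<open>L2\<close> comes from the norm of the complex inner product \<open>cinner\<close>; the real
  inner product required by the type class is its real part and induces the same norm.\<close>

instantiation L2 :: (euclidean_space) real_inner
begin

definition inner_L2_def: "inner (u :: 'a L2) v = Re (cinner u v)"

definition norm_L2_def: "norm (u :: 'a L2) = sqrt (Re (cinner u u))"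

definition sgn_L2_def: "sgn (u :: 'a L2) = inverse (norm u) *\<^sub>R u"

definition dist_L2_def: "dist (u :: 'a L2) v = norm (u - v)"

definition uniformity_L2_def:
  "(uniformity :: ('a L2 \<times> 'a L2) filter) = (INF e\<in>{0 <..}. principal {(x, y). dist x y < e})"

definition open_L2_def:
  "open (U :: 'a L2 set) \<longleftrightarrow> (\<forall>x\<in>U. eventually (\<lambda>(x', y). x' = x \<longrightarrow> y \<in> U) uniformity)"

instance
proof
  fix u v w :: "'a L2" and r :: real and U :: "'a L2 set"
  show "inner u v = inner v u"
    unfolding inner_L2_def by (subst cinner_commute) simp
  show "inner (u + v) w = inner u w + inner v w"
    by (simp add: inner_L2_def cinner_add_left)
  show "inner (r *\<^sub>R u) v = r * inner u v"
    by (simp add: inner_L2_def scaleR_L2_conv_cscale cinner_cscale_left)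
qed (simp_all add: inner_L2_def norm_L2_def sgn_L2_def dist_L2_def uniformity_L2_def open_L2_def
      cinner_self(2,3))

end

section \<open>Unbounded operators\<close>

text \<open>An operator on \<open>L2\<close>, defined on a subspace, is identified with its graph. Its domain is
  \<^const>\<open>Domain\<close> of the graph, and the operator closure is the topological closure of the graph in
  the product space.\<close>

type_synonym 'a L2_operator = "('a L2 \<times> 'a L2) set"

definition linear_operator :: "'a::euclidean_space L2_operator \<Rightarrow> bool" where
  "linear_operator A \<longleftrightarrow>
     single_valued A \<and> (0, 0) \<in> A \<and>
     (\<forall>u v u' v'. (u, v) \<in> A \<and> (u', v') \<in> A \<longrightarrow> (u + u', v + v') \<in> A) \<and>
     (\<forall>c u v. (u, v) \<in> A \<longrightarrow> (cscale c u, cscale c v) \<in> A)"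

definition densely_defined :: "'a::euclidean_space L2_operator \<Rightarrow> bool" where
  "densely_defined A \<longleftrightarrow> closure (Domain A) = UNIV"

definition op_adjoint :: "'a::euclidean_space L2_operator \<Rightarrow> 'a L2_operator" where
  "op_adjoint A = {(y, z). \<forall>(u, v) \<in> A. cinner v y = cinner u z}"

definition self_adjoint :: "'a::euclidean_space L2_operator \<Rightarrow> bool" where
  "self_adjoint A \<longleftrightarrow> linear_operator A \<and> densely_defined A \<and> op_adjoint A = A"

definition op_closure :: "'a::euclidean_space L2_operator \<Rightarrow> 'a L2_operator" where
  "op_closure A = closure A"

section \<open>The Laplacian on test functions away from the origin\<close>

definition partial_deriv ::
    "'a::euclidean_space \<Rightarrow> ('a \<Rightarrow> complex) \<Rightarrow> 'a \<Rightarrow> complex" where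
  "partial_deriv b f x = vector_derivative (\<lambda>t. f (x + t *\<^sub>R b)) (at 0)"

text \<open>\<open>foldr partial_deriv bs f\<close> is an iterated partial derivative of \<open>f\<close>. Differentiability of all
  of them makes all of them continuous.\<close>

definition smooth :: "('a::euclidean_space \<Rightarrow> complex) \<Rightarrow> bool" where
  "smooth f \<longleftrightarrow>
     (\<forall>bs x. set bs \<subseteq> Basis \<longrightarrow> foldr partial_deriv bs f differentiable (at x))"

text \<open>Functions in \<open>C_c_infinity U\<close> are extended by zero to the whole space.\<close>

definition C_c_infinity :: "'a::euclidean_space set \<Rightarrow> ('a \<Rightarrow> complex) set" where
  "C_c_infinity U =
     {f. smooth f \<and> compact (closure {x. f x \<noteq> 0}) \<and> closure {x. f x \<noteq> 0} \<subseteq> U}"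

definition neg_laplacian :: "('a::euclidean_space \<Rightarrow> complex) \<Rightarrow> 'a \<Rightarrow> complex" where
  "neg_laplacian f x = - (\<Sum>b\<in>Basis. partial_deriv b (partial_deriv b f) x)"

definition L_op :: "'a::euclidean_space L2_operator" where
  "L_op = {(abs_L2 f, abs_L2 (neg_laplacian f)) | f. f \<in> C_c_infinity (UNIV - {0})}"

text \<open>The functions to which \<^const>\<open>abs_L2\<close> is applied in \<^const>\<open>L_op\<close> are square-integrable.\<close>

lemma square_integrable_continuous_compact:
  fixes f :: "'a::euclidean_space \<Rightarrow> complex"
  assumes "continuous_on UNIV f" "compact K" "\<And>x. x \<notin> K \<Longrightarrow> f x = 0"
  shows "square_integrable f"
proof -
  have "integrable lborel (\<lambda>x. indicator K x *\<^sub>R (cmod (f x))\<^sup>2)"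
    using assms(1,2)
    by (intro borel_integrable_compact continuous_intros) (auto intro: continuous_on_subset)
  moreover have "(\<lambda>x. indicator K x *\<^sub>R (cmod (f x))\<^sup>2) = (\<lambda>x. (cmod (f x))\<^sup>2)"
    using assms(3) by (force simp: indicator_def)
  moreover have "f \<in> borel_measurable lborel"
    using borel_measurable_continuous_onI[OF assms(1)] by simp
  ultimately show ?thesis
    by (simp add: square_integrable_def)
qed

lemma partial_deriv_eq_0_outside:
  assumes "closed K" "\<And>x. x \<notin> K \<Longrightarrow> f x = 0" "x \<notin> K"
  shows "partial_deriv b f x = 0"
proof -
  have "open ((\<lambda>t::real. x + t *\<^sub>R b) -` (- K))"
    using assms(1) by (intro open_vimage continuous_intros) auto
  then have "\<forall>\<^sub>F t in nhds 0. x + t *\<^sub>R b \<in> - K"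
    using assms(3) unfolding eventually_nhds by (auto intro!: exI[of _ "(\<lambda>t. x + t *\<^sub>R b) -` (- K)"])
  then have "\<forall>\<^sub>F t in nhds 0. f (x + t *\<^sub>R b) = 0"
    by eventually_elim (use assms(2) in auto)
  then have "vector_derivative (\<lambda>t. f (x + t *\<^sub>R b)) (at 0) = vector_derivative (\<lambda>t. 0) (at (0::real))"
    by (intro vector_derivative_cong_eq) auto
  then show ?thesis
    by (simp add: partial_deriv_def)
qed

lemma square_integrable_test_function:
  assumes "f \<in> C_c_infinity U"
  shows "square_integrable f" "square_integrable (neg_laplacian f)"
proof -
  let ?K = "closure {x. f x \<noteq> 0}"
  have smooth: "smooth f" and K: "compact ?K"
    using assms by (auto simp: C_c_infinity_def)
  have f0: "f x = 0" if "x \<notin> ?K" for x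
    using that closure_subset[of "{x. f x \<noteq> 0}"] by auto
  have cont: "continuous_on UNIV (foldr partial_deriv bs f)" if "set bs \<subseteq> Basis" for bs
    using smooth that unfolding smooth_def
    by (auto intro!: continuous_at_imp_continuous_on differentiable_imp_continuous_within)
  show "square_integrable f"
    using cont[of "[]"] by (intro square_integrable_continuous_compact[OF _ K f0]) simp_all
  have "continuous_on UNIV (partial_deriv b (partial_deriv b f))" if "b \<in> Basis" for b
    using cont[of "[b, b]"] that by simp
  then have "continuous_on UNIV (neg_laplacian f)"
    unfolding neg_laplacian_def
    by (intro continuous_on_minus continuous_on_sum)
  moreover have "neg_laplacian f x = 0" if "x \<notin> ?K" for x
  proof -
    have "partial_deriv b f y = 0" if "y \<notin> ?K" for b y
      using f0 that by (rule partial_deriv_eq_0_outside[OF closed_closure])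
    then have "partial_deriv b (partial_deriv b f) x = 0" for b
      using that by (rule partial_deriv_eq_0_outside[OF closed_closure])
    then show ?thesis
      by (simp add: neg_laplacian_def)
  qed
  ultimately show "square_integrable (neg_laplacian f)"
    by (rule square_integrable_continuous_compact[OF _ K])
qed

end

(*
The operator L is symmetric and nonnegative, so its closure is self-adjoint as soon as the range of
L + 1 is dense, i.e. as soon as a square-integrable u that is orthogonal to (L + 1) f for all test
functions f away from the origin vanishes. Cutting off near the origin at scale eps costs a factor
eps^-2 * eps^(d/2) times the norm of u on a ball of radius proportional to eps. This tends to zero
for d >= 4, so u is in fact orthogonal to (L + 1) f for all test functions f on the whole space.
Correlating u with a fixed test function f then gives a bounded C^2 function w with Delta w = w,
and comparison with eps * (|x|^2 + 2 d) at a maximum shows w = 0. Test functions separate, so u = 0.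
*)

theory Submission
  imports Defs
begin


section \<open>Completeness of \<open>L2\<close>\<close>

text \<open>The single point -1 can replace the pair +i, -i because nonnegativity gives norm u \<le>
  norm ((L + 1) u), so one density statement controls the graph of the adjoint. Passing from a
  trivial orthogonal complement to density needs projections, hence the completeness of
  \<open>L2\<close>. In dimension 4 the square root of the volume of the ball exactly compensates
  the factor eps^-2. Smallness then comes from u alone, whose norm over shrinking balls tends to
  zero; a bound by the full norm of u would only cover d > 4. No regularity of u is available. Every
  derivative is put on the test function instead, by translation invariance of Lebesgue measure and
  dominated convergence. The comparison function is a supersolution, as its Laplacian 2 d eps is at
  most eps * (|x|^2 + 2 d). Since \<open>smooth\<close> speaks of all iterated partial derivatives,
  the cutoffs are shown smooth through classes of functions that are closed under
  differentiation.\<close>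

lemma L2_cases:
  fixes u :: "'a::euclidean_space L2"
  obtains f where "square_integrable f" "u = abs_L2 f"
proof -
  have "L2_eq (rep_L2 u) (rep_L2 u)" "abs_L2 (rep_L2 u) = u"
    using Quotient_rep_reflp[OF Quotient_L2] Quotient_abs_rep[OF Quotient_L2] by blast+
  then show ?thesis
    using that[of "rep_L2 u"] by (simp add: L2_eq_def)
qed

lemma L2_eq_refl: "square_integrable f \<Longrightarrow> L2_eq f f"
  by (simp add: L2_eq_def)

lemma cinner_abs_L2:
  "square_integrable f \<Longrightarrow> square_integrable g \<Longrightarrow>
    cinner (abs_L2 f) (abs_L2 g) = (\<integral>x. f x * cnj (g x) \<partial>lborel)"
  by (simp add: cinner.abs_eq L2_eq_refl)

lemma norm_abs_L2:
  "square_integrable f \<Longrightarrow> (norm (abs_L2 f))\<^sup>2 = (\<integral>x. (cmod (f x))\<^sup>2 \<partial>lborel)"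
  by (simp add: norm_L2_def cinner_self(2) cinner_abs_L2 flip: complex_norm_square of_real_power)

lemma abs_L2_eq_0_iff:
  "square_integrable f \<Longrightarrow> abs_L2 f = 0 \<longleftrightarrow> (AE x in lborel. f x = 0)"
  using Quotient_rel[OF Quotient_L2, of f "\<lambda>x. 0"]
  by (auto simp: zero_L2_def L2_eq_def square_integrable_zero)

lemma nn_integral_norm_abs_L2:
  assumes "square_integrable f"
  shows "(\<integral>\<^sup>+x. ennreal ((cmod (f x))\<^sup>2) \<partial>lborel) = ennreal ((norm (abs_L2 f))\<^sup>2)"
  using assms by (subst nn_integral_eq_integral) (auto simp: square_integrable_def norm_abs_L2)

section \<open>The sesquilinear form and its continuity\<close>

lemma cinner_diff_left: "cinner (u - v) w = cinner u w - cinner v w"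
proof -
  have "cinner ((u - v) + v) w = cinner (u - v) w + cinner v w"
    by (rule cinner_add_left)
  then show ?thesis by simp
qed

lemma cinner_add_right: "cinner u (v + w) = cinner u v + cinner u w"
  by (metis cinner_add_left cinner_commute complex_cnj_add)

lemma cinner_diff_right: "cinner u (v - w) = cinner u v - cinner u w"
  by (metis cinner_diff_left cinner_commute complex_cnj_diff)

lemma cinner_cscale_right: "cinner u (cscale c v) = cnj c * cinner u v"
  by (metis cinner_commute cinner_cscale_left complex_cnj_mult)

lemma cinner_zero_right: "cinner u 0 = 0"
  using cinner_diff_right[of u 0 0] by simp

lemma norm_cscale: "norm (cscale c u) = cmod c * norm u"
proof -
  have "cinner (cscale c u) (cscale c u) = of_real ((cmod c)\<^sup>2) * cinner u u"
    by (simp only: cinner_cscale_left cinner_cscale_right complex_norm_square mult_ac)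
  then show ?thesis
    by (simp add: norm_L2_def real_sqrt_mult)
qed

text \<open>Multiplying \<open>u\<close> by a phase \<open>c\<close> turns the inner product into
  its modulus, so the inequality for the real part, which comes from the class
  \<open>real_inner\<close>, already bounds the complex one.\<close>

lemma cinner_Cauchy_Schwarz: "cmod (cinner u v) \<le> norm u * norm v"
proof (cases "cinner u v = 0")
  case False
  define c where "c = cnj (cinner u v) / of_real (cmod (cinner u v))"
  have "cmod c = 1"
    using False by (simp add: c_def norm_divide)
  have "c * cinner u v = of_real (cmod (cinner u v))"
    using False unfolding c_def
    by (simp add: mult.commute[of "cnj _"] power2_eq_square flip: complex_norm_square)
  then have "cmod (cinner u v) = Re (cinner (cscale c u) v)"
    by (simp add: cinner_cscale_left)
  also have "\<dots> \<le> norm (cscale c u) * norm v"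
    using norm_cauchy_schwarz[of "cscale c u" v] by (simp add: inner_L2_def)
  finally show ?thesis
    by (simp add: norm_cscale \<open>cmod c = 1\<close>)
qed simp

lemma bounded_linear_cinner_left: "bounded_linear (\<lambda>u. cinner u v)"
proof (rule bounded_linear_intro)
  show "norm (cinner u v) \<le> norm u * norm v" for u
    by (rule cinner_Cauchy_Schwarz)
qed (simp_all add: cinner_add_left scaleR_L2_conv_cscale cinner_cscale_left scaleR_conv_of_real)

text \<open>A conjugate-linear map is still real-linear, which is enough for continuity.\<close>

lemma bounded_linear_cinner_right: "bounded_linear (\<lambda>v. cinner u v)"
proof (rule bounded_linear_intro)
  show "norm (cinner u v) \<le> norm v * norm u" for v
    using cinner_Cauchy_Schwarz[of u v] by (simp add: mult.commute)
qed (simp_all add: cinner_add_right scaleR_L2_conv_cscale cinner_cscale_right scaleR_conv_of_real)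

lemmas continuous_on_cinner_left [continuous_intros] =
  bounded_linear.continuous_on[OF bounded_linear_cinner_left]
lemmas continuous_on_cinner_right [continuous_intros] =
  bounded_linear.continuous_on[OF bounded_linear_cinner_right]

text \<open>A rapidly Cauchy subsequence converges almost everywhere, and Fatou's lemma identifies
  its pointwise limit as the limit in mean square. Nonnegative integrals postpone every
  integrability question to the end.\<close>

lemma Riesz_Fischer:
  fixes F :: "nat \<Rightarrow> 'a::euclidean_space \<Rightarrow> complex"
  assumes F: "\<And>n. square_integrable (F n)"
    and Cauchy: "\<And>n. \<exists>N. \<forall>m\<ge>N. \<forall>k\<ge>N.
      (\<integral>\<^sup>+x. ennreal ((cmod (F m x - F k x))\<^sup>2) \<partial>lborel) \<le> ennreal ((1/8) ^ n)"
  obtains f where "square_integrable f"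
    "\<And>n. \<exists>N. \<forall>k\<ge>N. (\<integral>\<^sup>+x. ennreal ((cmod (F k x - f x))\<^sup>2) \<partial>lborel) \<le> ennreal ((1/8) ^ n)"
proof -
  have [measurable]: "F n \<in> borel_measurable lborel" for n
    using F by (simp add: square_integrable_def)
  obtain N where N: "\<And>n m k. m \<ge> N n \<Longrightarrow> k \<ge> N n \<Longrightarrow>
      (\<integral>\<^sup>+x. ennreal ((cmod (F m x - F k x))\<^sup>2) \<partial>lborel) \<le> ennreal ((1/8) ^ n)"
    using Cauchy by metis
  \<comment> \<open>Partial sums of \<open>N\<close> give one monotone sequence of indices in which
    \<open>r m\<close> lies above every threshold \<open>N n\<close> with n \<le> m.\<close>
  define r where "r n = (\<Sum>i\<le>n. N i)" for n
  have rN: "N n \<le> r m" if "n \<le> m" for n m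
    unfolding r_def using that by (intro member_le_sum) auto
  define d where "d n x = F (r (Suc n)) x - F (r n) x" for n x
  have [measurable]: "d n \<in> borel_measurable lborel" for n
    unfolding d_def by measurable
  have "(\<integral>\<^sup>+x. (\<Sum>n. ennreal (4 ^ n * (cmod (d n x))\<^sup>2)) \<partial>lborel)
      = (\<Sum>n. \<integral>\<^sup>+x. ennreal (4 ^ n * (cmod (d n x))\<^sup>2) \<partial>lborel)"
    by (rule nn_integral_suminf) measurable
  \<comment> \<open>The weight 4^n against the increment bound (1/8)^n leaves (1/2)^n. Where the
    weighted series converges, its terms eventually fall below 1, so the increments are eventually
    at most (1/2)^n.\<close>
  also have "\<dots> \<le> (\<Sum>n. ennreal ((1/2) ^ n))"
  proof (rule suminf_le)
    fix n
    have "(\<integral>\<^sup>+x. ennreal (4 ^ n * (cmod (d n x))\<^sup>2) \<partial>lborel)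
        = ennreal (4 ^ n) * (\<integral>\<^sup>+x. ennreal ((cmod (d n x))\<^sup>2) \<partial>lborel)"
      by (simp add: ennreal_mult nn_integral_cmult)
    also have "\<dots> \<le> ennreal (4 ^ n) * ennreal ((1/8) ^ n)"
      unfolding d_def by (intro mult_left_mono N rN) auto
    also have "\<dots> = ennreal ((1/2) ^ n)"
      by (simp flip: ennreal_mult power_mult_distrib)
    finally show "(\<integral>\<^sup>+x. ennreal (4 ^ n * (cmod (d n x))\<^sup>2) \<partial>lborel) \<le> ennreal ((1/2) ^ n)" .
  qed auto
  also have "\<dots> < \<infinity>"
    by (subst suminf_ennreal2) (auto intro: summable_geometric)
  finally have "AE x in lborel. (\<Sum>n. ennreal (4 ^ n * (cmod (d n x))\<^sup>2)) \<noteq> \<infinity>"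
    by (intro nn_integral_PInf_AE) auto
  then have conv: "AE x in lborel. convergent (\<lambda>n. F (r n) x)"
  proof eventually_elim
    fix x
    assume "(\<Sum>n. ennreal (4 ^ n * (cmod (d n x))\<^sup>2)) \<noteq> \<infinity>"
    then have "summable (\<lambda>n. 4 ^ n * (cmod (d n x))\<^sup>2)"
      by (intro summable_suminf_not_top) auto
    then have "(\<lambda>n. 4 ^ n * (cmod (d n x))\<^sup>2) \<longlonglongrightarrow> 0"
      by (rule summable_LIMSEQ_zero)
    then have "\<forall>\<^sub>F n in sequentially. 4 ^ n * (cmod (d n x))\<^sup>2 < 1"
      by (rule order_tendstoD) simp
    then have "\<forall>\<^sub>F n in sequentially. norm (d n x) \<le> (1/2) ^ n"
    proof eventually_elim
      case (elim n)
      have "(2 ^ n * cmod (d n x))\<^sup>2 = 4 ^ n * (cmod (d n x))\<^sup>2"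
        by (simp add: power_mult_distrib power_even_eq[symmetric] mult.commute[of n])
          (simp add: power_mult)
      then have "(2 ^ n * cmod (d n x))\<^sup>2 \<le> 1\<^sup>2"
        using elim by simp
      then have "2 ^ n * cmod (d n x) \<le> 1"
        by (rule power2_le_imp_le) simp
      then show ?case
        by (simp add: power_divide field_simps)
    qed
    then have "summable (\<lambda>n. d n x)"
      by (rule summable_comparison_test_ev) (auto intro: summable_geometric)
    then have "convergent (\<lambda>n. \<Sum>i<n. d i x)"
      by (simp add: summable_iff_convergent)
    then have "convergent (\<lambda>n. F (r n) x - F (r 0) x)"
      unfolding d_def sum_lessThan_telescope[of "\<lambda>n. F (r n) x"] .
    then show "convergent (\<lambda>n. F (r n) x)"
      using convergent_diff_const_right_iff by blast
  qed
  define f where "f x = lim (\<lambda>n. F (r n) x)" for x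
  have [measurable]: "f \<in> borel_measurable lborel"
    unfolding f_def by (rule borel_measurable_lim_metric) simp
  \<comment> \<open>Only the second index runs along the subsequence, so the estimate holds for
    every \<open>k\<close> beyond \<open>N n\<close> and yields convergence of the whole
    sequence.\<close>
  have Fatou: "(\<integral>\<^sup>+x. ennreal ((cmod (F k x - f x))\<^sup>2) \<partial>lborel) \<le> ennreal ((1/8) ^ n)"
    if "k \<ge> N n" for n k
  proof -
    have "AE x in lborel. ennreal ((cmod (F k x - f x))\<^sup>2)
        = liminf (\<lambda>m. ennreal ((cmod (F k x - F (r m) x))\<^sup>2))"
      using conv
    proof eventually_elim
      case (elim x)
      then have "(\<lambda>m. F (r m) x) \<longlonglongrightarrow> f x"
        unfolding f_def by (simp add: convergent_LIMSEQ_iff)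
      then have "(\<lambda>m. ennreal ((cmod (F k x - F (r m) x))\<^sup>2)) \<longlonglongrightarrow> ennreal ((cmod (F k x - f x))\<^sup>2)"
        by (intro tendsto_intros) auto
      then show ?case
        by (intro lim_imp_Liminf[symmetric]) auto
    qed
    then have "(\<integral>\<^sup>+x. ennreal ((cmod (F k x - f x))\<^sup>2) \<partial>lborel)
        = (\<integral>\<^sup>+x. liminf (\<lambda>m. ennreal ((cmod (F k x - F (r m) x))\<^sup>2)) \<partial>lborel)"
      by (rule nn_integral_cong_AE)
    also have "\<dots> \<le> liminf (\<lambda>m. \<integral>\<^sup>+x. ennreal ((cmod (F k x - F (r m) x))\<^sup>2) \<partial>lborel)"
      by (rule nn_integral_liminf) measurable
    also have "\<dots> \<le> liminf (\<lambda>m. ennreal ((1/8) ^ n))"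
      by (intro Liminf_mono eventually_sequentiallyI[of n] N that rN)
    finally show ?thesis
      by (simp add: Liminf_const)
  qed
  have "square_integrable (\<lambda>x. F (N 0) x - f x)"
    unfolding square_integrable_def
    using le_less_trans[OF Fatou[of 0 "N 0"]] by (simp add: integrable_iff_bounded)
  then have "square_integrable f"
    using square_integrable_diff[OF F[of "N 0"]] by fastforce
  then show ?thesis
    using Fatou by (intro that) blast+
qed

instance L2 :: (euclidean_space) complete_space
proof
  fix X :: "nat \<Rightarrow> 'a L2"
  assume "Cauchy X"
  have "\<exists>f. square_integrable f \<and> X n = abs_L2 f" for n
    using L2_cases by metis
  then obtain F where F: "\<And>n. square_integrable (F n)" and X: "\<And>n. X n = abs_L2 (F n)"
    by metis
  have nn: "(\<integral>\<^sup>+x. ennreal ((cmod (f x - g x))\<^sup>2) \<partial>lborel) = ennreal ((dist (abs_L2 f) (abs_L2 g))\<^sup>2)"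
    if "square_integrable f" "square_integrable g" for f g :: "'a \<Rightarrow> complex"
    using that nn_integral_norm_abs_L2[of "\<lambda>x. f x - g x"]
    by (simp add: dist_norm minus_L2.abs_eq L2_eq_refl square_integrable_diff)
  have "\<exists>N. \<forall>m\<ge>N. \<forall>k\<ge>N.
      (\<integral>\<^sup>+x. ennreal ((cmod (F m x - F k x))\<^sup>2) \<partial>lborel) \<le> ennreal ((1/8) ^ n)" for n
  proof -
    obtain N where N: "\<And>m k. m \<ge> N \<Longrightarrow> k \<ge> N \<Longrightarrow> dist (X m) (X k) < sqrt ((1/8) ^ n)"
      using \<open>Cauchy X\<close> unfolding Cauchy_def by (metis real_sqrt_gt_zero zero_less_divide_1_iff zero_less_numeral zero_less_power)
    have "(dist (X m) (X k))\<^sup>2 \<le> (sqrt ((1/8) ^ n))\<^sup>2" if "m \<ge> N" "k \<ge> N" for m k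
      using N[OF that] by (intro power_mono) auto
    then show ?thesis
      by (intro exI[of _ N]) (auto simp: nn F ennreal_le_iff X)
  qed
  from Riesz_Fischer[OF F this] obtain f where f: "square_integrable f"
    and lim: "\<And>n. \<exists>N. \<forall>k\<ge>N. (\<integral>\<^sup>+x. ennreal ((cmod (F k x - f x))\<^sup>2) \<partial>lborel) \<le> ennreal ((1/8) ^ n)"
    by blast
  have "X \<longlonglongrightarrow> abs_L2 f"
  proof (rule metric_LIMSEQ_I)
    fix e :: real
    assume "e > 0"
    then obtain n where n: "(1/8) ^ n < e\<^sup>2"
      using real_arch_pow_inv[of "e\<^sup>2" "1/8"] by auto
    obtain N where "\<And>k. k \<ge> N \<Longrightarrow> (dist (X k) (abs_L2 f))\<^sup>2 \<le> (1/8) ^ n"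
      using lim[of n] by (auto simp: nn F f X ennreal_le_iff)
    then have "(dist (X k) (abs_L2 f))\<^sup>2 < e\<^sup>2" if "k \<ge> N" for k
      using n that by (meson le_less_trans)
    then show "\<exists>N. \<forall>k\<ge>N. dist (X k) (abs_L2 f) < e"
      using \<open>e > 0\<close> by (meson power2_less_imp_less less_imp_le)
  qed
  then show "convergent X"
    by (auto simp: convergent_def)
qed

section \<open>Self-adjointness of the closure of a nonnegative symmetric operator\<close>

text \<open>This is the projection theorem: a sequence in \<open>S\<close> minimizing the distance
  to \<open>x\<close> converges to some \<open>p\<close>, and \<open>x - p\<close> is orthogonal to
  \<open>S\<close>, hence zero.\<close>

lemma dense_subspace_criterion:
  fixes S :: "'v::{real_inner, complete_space} set"
  assumes S: "subspace S" and orth: "\<And>w. (\<And>s. s \<in> S \<Longrightarrow> inner s w = 0) \<Longrightarrow> w = 0"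
  shows "closure S = UNIV"
proof -
  have "x \<in> closure S" for x
  proof -
    define \<delta> where "\<delta> = infdist x S"
    have "S \<noteq> {}" and "0 \<in> S"
      using S subspace_0 by auto
    have \<delta>: "\<delta> \<le> norm (x - s)" if "s \<in> S" for s
      unfolding \<delta>_def using infdist_le[OF that, of x] by (simp add: dist_norm)
    have "\<delta> \<ge> 0"
      by (simp add: \<delta>_def infdist_nonneg)
    have "\<exists>s\<in>S. norm (x - s) < \<delta> + inverse (Suc n)" for n
    proof (rule ccontr)
      assume "\<not> ?thesis"
      then have "\<delta> + inverse (Suc n) \<le> infdist x S"
        unfolding infdist_notempty[OF \<open>S \<noteq> {}\<close>]
        by (intro cINF_greatest[OF \<open>S \<noteq> {}\<close>]) (auto simp: dist_norm not_less)
      then show False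
        by (simp add: \<delta>_def)
    qed
    then obtain s where sS: "\<And>n. s n \<in> S" and s: "\<And>n. norm (x - s n) < \<delta> + inverse (Suc n)"
      by metis
    have lim: "(\<lambda>n. norm (x - s n)) \<longlonglongrightarrow> \<delta>"
    proof (rule tendsto_sandwich[of "\<lambda>n. \<delta>" _ _ "\<lambda>n. \<delta> + inverse (Suc n)"])
      show "(\<lambda>n. \<delta> + inverse (real (Suc n))) \<longlonglongrightarrow> \<delta>"
        using tendsto_add[OF tendsto_const LIMSEQ_inverse_real_of_nat, of \<delta>] by simp
    qed (use s \<delta> sS in \<open>auto intro!: always_eventually less_imp_le\<close>)
    \<comment> \<open>Midpoints stay in \<open>S\<close>, at distance at least \<delta> from
      \<open>x\<close>; the parallelogram law turns this into closeness of the two points.\<close>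
    have par: "(norm (s m - s k))\<^sup>2 \<le> 2 * ((norm (x - s m))\<^sup>2 - \<delta>\<^sup>2) + 2 * ((norm (x - s k))\<^sup>2 - \<delta>\<^sup>2)" for m k
    proof -
      have "(1/2) *\<^sub>R (s m + s k) \<in> S"
        by (intro subspace_scale[OF S] subspace_add[OF S] sS)
      then have "\<delta>\<^sup>2 \<le> (norm (x - (1/2) *\<^sub>R (s m + s k)))\<^sup>2"
        by (intro power_mono \<delta> \<open>\<delta> \<ge> 0\<close>)
      moreover have "(norm (s m - s k))\<^sup>2 + 4 * (norm (x - (1/2) *\<^sub>R (s m + s k)))\<^sup>2
          = 2 * (norm (x - s m))\<^sup>2 + 2 * (norm (x - s k))\<^sup>2"
        unfolding power2_norm_eq_inner
        by (simp add: inner_simps inner_commute algebra_simps)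
      ultimately show ?thesis
        by argo
    qed
    have "Cauchy s"
    proof (rule metric_CauchyI)
      fix e :: real
      assume "e > 0"
      have "(\<lambda>n. (norm (x - s n))\<^sup>2 - \<delta>\<^sup>2) \<longlonglongrightarrow> \<delta>\<^sup>2 - \<delta>\<^sup>2"
        by (intro tendsto_intros lim)
      then have "\<forall>\<^sub>F n in sequentially. (norm (x - s n))\<^sup>2 - \<delta>\<^sup>2 < e\<^sup>2 / 4"
        using \<open>e > 0\<close> by (intro order_tendstoD(2)) auto
      then obtain N where N: "\<And>n. n \<ge> N \<Longrightarrow> (norm (x - s n))\<^sup>2 - \<delta>\<^sup>2 < e\<^sup>2 / 4"
        by (auto simp: eventually_sequentially)
      have "(norm (s m - s k))\<^sup>2 < e\<^sup>2" if "m \<ge> N" "k \<ge> N" for m k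
        using par[of m k] N[OF that(1)] N[OF that(2)] by argo
      then show "\<exists>M. \<forall>m\<ge>M. \<forall>n\<ge>M. dist (s m) (s n) < e"
        using \<open>e > 0\<close> unfolding dist_norm by (meson power2_less_imp_less less_imp_le)
    qed
    then obtain p where p: "s \<longlonglongrightarrow> p"
      using Cauchy_convergent convergent_def by blast
    then have pS: "p \<in> closure S"
      using sS closure_sequential by blast
    have "(\<lambda>n. norm (x - s n)) \<longlonglongrightarrow> norm (x - p)"
      by (intro tendsto_intros p)
    then have norm_p: "norm (x - p) = \<delta>"
      using lim LIMSEQ_unique by blast
    have min: "\<delta> \<le> norm (x - q)" if "q \<in> closure S" for q
      using that \<delta>_def infdist_le[of q "closure S" x] infdist_eq_setdist[of x S] infdist_eq_setdist[of x "closure S"]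
      by (simp add: dist_norm)
    have "inner h (x - p) = 0" if "h \<in> S" for h
    proof (cases "h = 0")
      case False
      \<comment> \<open>The minimizer of the quadratic function t \<mapsto> norm (x - p - t h)^2.
        Its minimum lies below \<delta>^2 unless \<open>h\<close> is orthogonal to
        \<open>x - p\<close>.\<close>
      define t where "t = inner h (x - p) / inner h h"
      have "inner h h > 0"
        using False by simp
      have "p + t *\<^sub>R h \<in> closure S"
        unfolding closure_sequential
        by (intro exI[of _ "\<lambda>n. s n + t *\<^sub>R h"] conjI allI tendsto_intros p
            subspace_add[OF S] subspace_scale[OF S] sS that)
      then have "\<delta>\<^sup>2 \<le> (norm (x - (p + t *\<^sub>R h)))\<^sup>2"
        by (intro power_mono min \<open>\<delta> \<ge> 0\<close>)
      also have "\<dots> = \<delta>\<^sup>2 - 2 * t * inner h (x - p) + t * t * inner h h"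
        unfolding norm_p[symmetric] power2_norm_eq_inner
        by (simp add: inner_simps inner_commute algebra_simps)
      also have "\<dots> = \<delta>\<^sup>2 - (inner h (x - p))\<^sup>2 / inner h h"
        using \<open>inner h h > 0\<close> by (simp add: t_def field_simps power2_eq_square)
      finally have "(inner h (x - p))\<^sup>2 / inner h h \<le> 0"
        by simp
      then show ?thesis
        using \<open>inner h h > 0\<close> by (simp add: divide_le_0_iff)
    qed simp
    then have "x - p = 0"
      by (rule orth)
    then show ?thesis
      using pS by simp
  qed
  then show ?thesis
    by auto
qed

section \<open>Complex subspaces, adjoints and closures of graphs\<close>

definition csubspace :: "'a::euclidean_space L2 set \<Rightarrow> bool" where
  "csubspace S \<longleftrightarrow> 0 \<in> S \<and> (\<forall>u\<in>S. \<forall>v\<in>S. u + v \<in> S) \<and> (\<forall>c. \<forall>u\<in>S. cscale c u \<in> S)"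

text \<open>On a complex subspace, orthogonality for the real inner product is full orthogonality:
  pairing \<open>cscale (- \<i>) s\<close> with \<open>w\<close> has as real part the imaginary part
  of pairing \<open>s\<close> with \<open>w\<close>.\<close>

lemma closure_csubspace_eq_UNIV:
  assumes S: "csubspace S" and orth: "\<And>w. (\<And>s. s \<in> S \<Longrightarrow> cinner s w = 0) \<Longrightarrow> w = 0"
  shows "closure S = UNIV"
proof (rule dense_subspace_criterion)
  show "subspace S"
    using S by (auto simp: subspace_def csubspace_def scaleR_L2_conv_cscale)
  fix w
  assume w: "inner s w = 0" if "s \<in> S" for s
  have "cinner s w = 0" if "s \<in> S" for s
  proof -
    have "cscale (- \<i>) s \<in> S"
      using S that by (auto simp: csubspace_def)
    then have "Re (cinner s w) = 0" "Im (cinner s w) = 0"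
      using w[OF that] w[of "cscale (- \<i>) s"] by (simp_all add: inner_L2_def cinner_cscale_left)
    then show ?thesis
      by (simp add: complex_eq_iff)
  qed
  then show "w = 0"
    by (rule orth)
qed

lemma op_adjoint_iff:
  "(y, z) \<in> op_adjoint A \<longleftrightarrow> (\<forall>u v. (u, v) \<in> A \<longrightarrow> cinner v y = cinner u z)"
  by (auto simp: op_adjoint_def)

lemma closed_op_adjoint:
  fixes A :: "'a::euclidean_space L2_operator"
  shows "closed (op_adjoint A)"
proof -
  have "op_adjoint A = (\<Inter>p\<in>A. {q. cinner (snd p) (fst q) = cinner (fst p) (snd q)})"
    by (force simp: op_adjoint_iff)
  moreover have "closed {q. cinner (snd p) (fst q) = cinner (fst p) (snd q)}"
    for p :: "'a L2 \<times> 'a L2"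
    by (intro closed_Collect_eq continuous_intros)
  ultimately show ?thesis
    by (simp add: closed_INT)
qed

text \<open>For a fixed candidate \<open>q\<close> the adjoint equation is a closed condition on the
  pairs of the graph, so it passes from \<open>A\<close> to its closure.\<close>

lemma op_adjoint_closure:
  fixes A :: "'a::euclidean_space L2_operator"
  shows "op_adjoint (closure A) = op_adjoint A"
proof
  show "op_adjoint (closure A) \<subseteq> op_adjoint A"
    using closure_subset[of A] by (auto simp: op_adjoint_def)
  show "op_adjoint A \<subseteq> op_adjoint (closure A)"
  proof
    fix q
    assume q: "q \<in> op_adjoint A"
    have "closure A \<subseteq> {p. cinner (snd p) (fst q) = cinner (fst p) (snd q)}"
    proof (rule closure_minimal)
      show "A \<subseteq> {p. cinner (snd p) (fst q) = cinner (fst p) (snd q)}"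
        using q by (auto simp: op_adjoint_def)
      show "closed {p. cinner (snd p) (fst q) = cinner (fst p) (snd q)}"
        by (intro closed_Collect_eq continuous_intros)
    qed
    then show "q \<in> op_adjoint (closure A)"
      by (auto simp: op_adjoint_def)
  qed
qed

text \<open>Density makes the adjoint single-valued: two values at one point differ by a vector
  orthogonal to the domain.\<close>

lemma linear_operator_op_adjoint:
  assumes "closure (Domain A) = UNIV"
  shows "linear_operator (op_adjoint A)"
  unfolding linear_operator_def
proof (intro conjI allI impI)
  show "single_valued (op_adjoint A)"
  proof (rule single_valuedI)
    fix y z z'
    assume "(y, z) \<in> op_adjoint A" "(y, z') \<in> op_adjoint A"
    then have "cinner u (z - z') = 0" if "u \<in> Domain A" for u
      using that by (fastforce simp: op_adjoint_def cinner_diff_right)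
    then have "Domain A \<subseteq> {u. cinner u (z - z') = 0}"
      by auto
    moreover have "closed {u. cinner u (z - z') = 0}"
      by (intro closed_Collect_eq continuous_intros)
    ultimately have "closure (Domain A) \<subseteq> {u. cinner u (z - z') = 0}"
      by (rule closure_minimal)
    then have "cinner (z - z') (z - z') = 0"
      using assms by auto
    then show "z = z'"
      using cinner_self(3)[of "z - z'"] by simp
  qed
qed (auto simp: op_adjoint_iff cinner_zero_right cinner_add_right cinner_cscale_right)

text \<open>Symmetry places the closure inside the adjoint. Conversely, for \<open>(y, z)\<close> in
  the adjoint, approximate \<open>y + z\<close> by sums \<open>u n + v n\<close> with
  \<open>(u n, v n)\<close> in \<open>A\<close>. Nonnegativity makes the inverse of A + 1 a
  contraction, which forces \<open>u n\<close> to tend to \<open>y\<close> and then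
  \<open>v n\<close> to \<open>z\<close>.\<close>

theorem self_adjoint_closure_of_nonneg:
  assumes A: "csubspace (Domain A)" "csubspace {u + v | u v. (u, v) \<in> A}"
    and sym: "\<And>u v u' v'. (u, v) \<in> A \<Longrightarrow> (u', v') \<in> A \<Longrightarrow> cinner v u' = cinner u v'"
    and nonneg: "\<And>u v. (u, v) \<in> A \<Longrightarrow> 0 \<le> Re (cinner v u)"
    and dom: "\<And>w. (\<And>u. u \<in> Domain A \<Longrightarrow> cinner u w = 0) \<Longrightarrow> w = 0"
    and ran: "\<And>w. (\<And>u v. (u, v) \<in> A \<Longrightarrow> cinner (u + v) w = 0) \<Longrightarrow> w = 0"
  shows "self_adjoint (op_closure A)"
proof -
  let ?R = "{u + v | u v. (u, v) \<in> A}"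
  have dense_dom: "closure (Domain A) = UNIV"
    by (rule closure_csubspace_eq_UNIV[OF A(1) dom])
  have dense_ran: "closure ?R = UNIV"
    by (rule closure_csubspace_eq_UNIV[OF A(2) ran]) blast
  have "A \<subseteq> op_adjoint A"
    using sym by (auto simp: op_adjoint_def)
  then have "closure A \<subseteq> op_adjoint A"
    by (rule closure_minimal[OF _ closed_op_adjoint])
  moreover have "op_adjoint A \<subseteq> closure A"
  proof (rule subrelI)
    fix y z
    assume yz: "(y, z) \<in> op_adjoint A"
    have "y + z \<in> closure ?R"
      using dense_ran by simp
    then obtain s where "\<And>n. s n \<in> ?R" and s_lim: "s \<longlonglongrightarrow> y + z"
      by (auto simp: closure_sequential)
    then have "\<forall>n. \<exists>u v. (u, v) \<in> A \<and> s n = u + v"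
      by blast
    then obtain u v where uv: "\<And>n. (u n, v n) \<in> A" and s: "\<And>n. s n = u n + v n"
      by metis
    have bound: "norm (u n - y) \<le> norm (s n - (y + z))" for n
    proof -
      let ?w = "u n - y" and ?g = "s n - (y + z)"
      \<comment> \<open>Moving A + 1 across the inner product, by symmetry for \<open>u n\<close>
        and by the adjoint relation for \<open>y\<close>, replaces \<open>?w\<close> by the
        approximation error \<open>?g\<close>.\<close>
      have "cmod (cinner r ?w) \<le> norm r * norm ?g" if r_ran: "r \<in> ?R" for r
      proof -
        obtain h k where hk: "(h, k) \<in> A" and r: "r = h + k"
          using r_ran by auto
        have "cinner r ?w = cinner h ?g"
          using sym[OF hk uv[of n]] yz hk
          by (auto simp: r s cinner_add_left cinner_diff_right cinner_add_right op_adjoint_iff)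
        then have "cmod (cinner r ?w) \<le> norm h * norm ?g"
          using cinner_Cauchy_Schwarz by metis
        \<comment> \<open>In the expansion of norm (h + k)^2 the cross term is twice
          \<open>Re (cinner k h)\<close>, which is nonnegative.\<close>
        also have "(norm h)\<^sup>2 \<le> (norm r)\<^sup>2"
          using nonneg[OF hk] unfolding r power2_norm_eq_inner
          by (simp add: inner_add_left inner_add_right inner_commute[of h k])
            (simp add: inner_L2_def cinner_self(2))
        then have "norm h * norm ?g \<le> norm r * norm ?g"
          by (intro mult_right_mono) (auto dest: power2_le_imp_le)
        finally show ?thesis .
      qed
      \<comment> \<open>The estimate is a closed condition on \<open>r\<close> and \<open>?R\<close>
        is dense, so \<open>r\<close> may be taken to be \<open>?w\<close> itself.\<close>
      then have "?R \<subseteq> {r. cmod (cinner r ?w) \<le> norm r * norm ?g}"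
        by blast
      moreover have "closed {r. cmod (cinner r ?w) \<le> norm r * norm ?g}"
        by (intro closed_Collect_le continuous_intros)
      ultimately have "closure ?R \<subseteq> {r. cmod (cinner r ?w) \<le> norm r * norm ?g}"
        by (rule closure_minimal)
      then have "cmod (cinner ?w ?w) \<le> norm ?w * norm ?g"
        using dense_ran by auto
      moreover have "cmod (cinner ?w ?w) = norm ?w * norm ?w"
        using cinner_self(2)[of ?w] by (subst cinner_self(1)) (simp add: norm_L2_def)
      ultimately show ?thesis
        by (cases "norm ?w = 0") (auto simp: mult_le_cancel_left)
    qed
    have "(\<lambda>n. s n - (y + z)) \<longlonglongrightarrow> 0"
      using s_lim by (rule LIM_zero)
    then have "(\<lambda>n. u n - y) \<longlonglongrightarrow> 0"
      by (rule Lim_null_comparison[OF always_eventually tendsto_norm_zero, rotated])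
        (use bound in auto)
    then have u_lim: "u \<longlonglongrightarrow> y"
      by (rule LIM_zero_cancel)
    have "(\<lambda>n. s n - u n) \<longlonglongrightarrow> (y + z) - y"
      by (intro tendsto_intros s_lim u_lim)
    then have "v \<longlonglongrightarrow> z"
      by (simp add: s)
    with u_lim have "(\<lambda>n. (u n, v n)) \<longlonglongrightarrow> (y, z)"
      by (rule tendsto_Pair)
    then show "(y, z) \<in> closure A"
      unfolding closure_sequential using uv by (intro exI[of _ "\<lambda>n. (u n, v n)"]) auto
  qed
  ultimately have eq: "closure A = op_adjoint A"
    by auto
  moreover have "densely_defined (closure A)"
  proof -
    have "Domain A \<subseteq> Domain (closure A)"
      by (intro Domain_mono closure_subset)
    then show ?thesis
      unfolding densely_defined_def using dense_dom closure_mono by blast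
  qed
  ultimately show ?thesis
    unfolding self_adjoint_def op_closure_def
    using linear_operator_op_adjoint[OF dense_dom] op_adjoint_closure[of A] by simp
qed


section \<open>Smooth functions\<close>

lemma partial_deriv_eq:
  assumes "(f has_derivative D) (at x)"
  shows "partial_deriv b f x = D b"
proof -
  have "((\<lambda>t. x + t *\<^sub>R b) has_derivative (\<lambda>t. t *\<^sub>R b)) (at 0)"
    by (auto intro!: derivative_eq_intros)
  then have "((\<lambda>t. f (x + t *\<^sub>R b)) has_derivative (\<lambda>t. D (t *\<^sub>R b))) (at 0)"
    by (rule has_derivative_compose) (use assms in simp)
  moreover have "D (t *\<^sub>R b) = t *\<^sub>R D b" for t
    using assms by (simp add: has_derivative_linear linear_cmul)
  ultimately have "((\<lambda>t. f (x + t *\<^sub>R b)) has_vector_derivative D b) (at 0)"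
    by (simp add: has_vector_derivative_def)
  then show ?thesis
    unfolding partial_deriv_def by (rule vector_derivative_at)
qed

lemma has_vector_derivative_partial_deriv:
  assumes "f differentiable (at (x + t *\<^sub>R b))"
  shows "((\<lambda>s. f (x + s *\<^sub>R b)) has_vector_derivative partial_deriv b f (x + t *\<^sub>R b)) (at t)"
proof -
  obtain D where D: "(f has_derivative D) (at (x + t *\<^sub>R b))"
    using assms by (auto simp: differentiable_def)
  have "((\<lambda>t. x + t *\<^sub>R b) has_derivative (\<lambda>t. t *\<^sub>R b)) (at t)"
    by (auto intro!: derivative_eq_intros)
  then have "((\<lambda>s. f (x + s *\<^sub>R b)) has_derivative (\<lambda>s. D (s *\<^sub>R b))) (at t)"
    by (rule has_derivative_compose) (rule D)
  moreover have "D (s *\<^sub>R b) = s *\<^sub>R D b" for s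
    using D by (simp add: has_derivative_linear linear_cmul)
  ultimately show ?thesis
    by (simp add: has_vector_derivative_def partial_deriv_eq[OF D])
qed

lemma partial_deriv_const: "partial_deriv b (\<lambda>x. c) = (\<lambda>x. 0)"
  by (rule ext) (rule partial_deriv_eq[OF has_derivative_const])

lemma partial_deriv_add:
  assumes "\<And>x. f differentiable (at x)" "\<And>x. g differentiable (at x)"
  shows "partial_deriv b (\<lambda>x. f x + g x) = (\<lambda>x. partial_deriv b f x + partial_deriv b g x)"
proof
  fix x
  obtain D D' where "(f has_derivative D) (at x)" "(g has_derivative D') (at x)"
    using assms by (metis differentiable_def)
  then show "partial_deriv b (\<lambda>x. f x + g x) x = partial_deriv b f x + partial_deriv b g x"
    using partial_deriv_eq has_derivative_add by metis
qed

lemma partial_deriv_mult: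
  assumes "\<And>x. f differentiable (at x)" "\<And>x. g differentiable (at x)"
  shows "partial_deriv b (\<lambda>x. f x * g x) = (\<lambda>x. partial_deriv b f x * g x + f x * partial_deriv b g x)"
proof
  fix x
  obtain D D' where D: "(f has_derivative D) (at x)" "(g has_derivative D') (at x)"
    using assms by (metis differentiable_def)
  show "partial_deriv b (\<lambda>x. f x * g x) x = partial_deriv b f x * g x + f x * partial_deriv b g x"
    using partial_deriv_eq[OF has_derivative_mult[OF D], of b]
      partial_deriv_eq[OF D(1), of b] partial_deriv_eq[OF D(2), of b] by simp
qed

lemma partial_deriv_cmult:
  assumes "\<And>x. f differentiable (at x)"
  shows "partial_deriv b (\<lambda>x. c * f x) = (\<lambda>x. c * partial_deriv b f x)"
  using assms by (subst partial_deriv_mult) (auto simp: partial_deriv_const)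

lemma partial_deriv_cnj:
  assumes "\<And>x. f differentiable (at x)"
  shows "partial_deriv b (\<lambda>x. cnj (f x)) = (\<lambda>x. cnj (partial_deriv b f x))"
proof
  fix x
  obtain D where D: "(f has_derivative D) (at x)"
    using assms by (metis differentiable_def)
  then have "((\<lambda>x. cnj (f x)) has_derivative (\<lambda>h. cnj (D h))) (at x)"
    by (rule bounded_linear.has_derivative[OF bounded_linear_cnj])
  then show "partial_deriv b (\<lambda>x. cnj (f x)) x = cnj (partial_deriv b f x)"
    using partial_deriv_eq D by metis
qed

lemma has_derivative_affine_comp:
  fixes a :: "'a::real_normed_vector"
  assumes "(f has_derivative D) (at (c *\<^sub>R x + a))"
  shows "((\<lambda>x. f (c *\<^sub>R x + a)) has_derivative (\<lambda>h. D (c *\<^sub>R h))) (at x)"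
proof -
  have "((\<lambda>x. c *\<^sub>R x + a) has_derivative (\<lambda>h. c *\<^sub>R h)) (at x)"
    by (auto intro!: derivative_eq_intros)
  then show ?thesis
    by (rule has_derivative_compose) (rule assms)
qed

lemma partial_deriv_affine:
  assumes "\<And>x. f differentiable (at x)"
  shows "partial_deriv b (\<lambda>x. f (c *\<^sub>R x + a)) = (\<lambda>x. of_real c * partial_deriv b f (c *\<^sub>R x + a))"
proof
  fix x
  obtain D where D: "(f has_derivative D) (at (c *\<^sub>R x + a))"
    using assms by (metis differentiable_def)
  have "partial_deriv b (\<lambda>x. f (c *\<^sub>R x + a)) x = D (c *\<^sub>R b)"
    using D by (intro partial_deriv_eq has_derivative_affine_comp)
  also have "\<dots> = of_real c * D b"
    using D by (simp add: has_derivative_linear linear_cmul scaleR_conv_of_real)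
  finally show "partial_deriv b (\<lambda>x. f (c *\<^sub>R x + a)) x = of_real c * partial_deriv b f (c *\<^sub>R x + a)"
    by (simp add: partial_deriv_eq[OF D])
qed

lemma partial_deriv_translate:
  assumes "\<And>x. f differentiable (at x)"
  shows "partial_deriv b (\<lambda>x. f (x - a)) = (\<lambda>x. partial_deriv b f (x - a))"
  using partial_deriv_affine[of f b 1 "- a"] assms by simp

section \<open>Smoothness by invariant classes\<close>

lemma smooth_differentiable: "smooth f \<Longrightarrow> f differentiable (at x)"
  unfolding smooth_def by (elim allE[of _ "[]"]) simp

lemma smooth_partial_deriv:
  assumes "smooth f" "b \<in> Basis"
  shows "smooth (partial_deriv b f)"
  unfolding smooth_def
proof (intro allI impI)
  fix bs :: "'a list" and x
  assume "set bs \<subseteq> Basis"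
  then show "foldr partial_deriv bs (partial_deriv b f) differentiable (at x)"
    using assms unfolding smooth_def by (elim allE[of _ "bs @ [b]"]) auto
qed

text \<open>Exhibiting an invariant class replaces explicit formulas for the iterated derivatives of
  products and compositions.\<close>

lemma smooth_coinduct:
  assumes "P f" and P: "\<And>f x. P f \<Longrightarrow> f differentiable (at x)"
    "\<And>f b. P f \<Longrightarrow> b \<in> Basis \<Longrightarrow> P (partial_deriv b f)"
  shows "smooth f"
  unfolding smooth_def
proof (intro allI impI)
  fix bs :: "'a list" and x
  assume "set bs \<subseteq> Basis"
  \<comment> \<open>\<open>foldr\<close> applies the last direction of the list first, so the
    induction peels directions off the end and replaces \<open>f\<close> by one of its partial
    derivatives.\<close>
  then show "foldr partial_deriv bs f differentiable (at x)"
    using \<open>P f\<close> by (induction bs arbitrary: f rule: rev_induct) (auto intro: P)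
qed

lemma smooth_const [simp]: "smooth (\<lambda>x. c)"
  by (rule smooth_coinduct[where P="\<lambda>f. \<exists>c. f = (\<lambda>x. c)"]) (auto simp: partial_deriv_const)

lemma smooth_inner: "smooth (\<lambda>x. complex_of_real (x \<bullet> a))"
proof -
  have D: "((\<lambda>x. complex_of_real (x \<bullet> a)) has_derivative (\<lambda>h. complex_of_real (h \<bullet> a))) (at x)" for x
    by (intro derivative_intros bounded_linear.has_derivative[OF bounded_linear_of_real])
  then have "partial_deriv b (\<lambda>x. complex_of_real (x \<bullet> a)) = (\<lambda>x. complex_of_real (b \<bullet> a))" for b
    by (intro ext partial_deriv_eq)
  then show ?thesis
    using D
    by (intro smooth_coinduct[where P="\<lambda>f. f = (\<lambda>x. complex_of_real (x \<bullet> a)) \<or> (\<exists>c. f = (\<lambda>x. c))"])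
      (auto simp: partial_deriv_const intro: differentiableI)
qed

section \<open>A family of flat functions, closed under differentiation\<close>

text \<open>\<open>flat 0\<close> is the classical smooth function vanishing to infinite order at 0.
  The powers of \<open>t\<close> in the denominator are there because differentiation creates them:
  derivatives stay linear combinations of members of the family.\<close>

definition flat :: "nat \<Rightarrow> real \<Rightarrow> real" where
  "flat k t = (if t \<le> 0 then 0 else exp (- 1 / t) / t ^ k)"

lemma flat_nonpos: "t \<le> 0 \<Longrightarrow> flat k t = 0"
  by (simp add: flat_def)

lemma flat_0_pos: "t > 0 \<Longrightarrow> flat 0 t = exp (- 1 / t)"
  by (simp add: flat_def)

lemma flat_0_bounds: "0 \<le> flat 0 t" "flat 0 t \<le> 1"
  by (auto simp: flat_def)

lemma flat_tendsto_0: "(flat k \<longlongrightarrow> 0) (at 0)"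
proof (rule filterlim_split_at)
  have "((\<lambda>t. 0) \<longlongrightarrow> 0) (at_left (0::real))"
    by simp
  then show "(flat k \<longlongrightarrow> 0) (at_left 0)"
    by (rule Lim_transform_eventually)
      (auto simp: eventually_at_left_field flat_def intro!: exI[of _ "-1"])
  have "((\<lambda>t. inverse t ^ k / exp (inverse t)) \<longlongrightarrow> 0) (at_right (0::real))"
    using filterlim_compose[OF tendsto_power_div_exp_0 filterlim_inverse_at_top_right] .
  then show "(flat k \<longlongrightarrow> 0) (at_right 0)"
    by (rule Lim_transform_eventually)
      (auto simp: eventually_at_right_field flat_def exp_minus field_simps intro!: exI[of _ 1])
qed

lemma DERIV_flat: "(flat k has_real_derivative flat (k + 2) t - k * flat (k + 1) t) (at t)"
proof -
  consider "t < 0" | "t = 0" | "t > 0"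
    by linarith
  then show ?thesis
  proof cases
    case 1
    then have "((\<lambda>t. 0) has_real_derivative flat (k + 2) t - k * flat (k + 1) t) (at t)"
      by (simp add: flat_def)
    then show ?thesis
      by (rule has_field_derivative_transform_within_open[of _ _ _ "{..<0}"])
        (use 1 in \<open>auto simp: flat_def\<close>)
  next
    case 2
    \<comment> \<open>At the origin the difference quotient of \<open>flat k\<close> is itself a
      member of the family, whose limit 0 is already known.\<close>
    have "(\<lambda>h. (flat k (0 + h) - flat k 0) / h) = flat (k + 1)"
      by (auto simp: flat_def)
    then show ?thesis
      using flat_tendsto_0[of "k + 1"] 2 by (simp add: DERIV_def flat_nonpos)
  next
    case 3
    have "((\<lambda>t. exp (- 1 / t) / t ^ k) has_real_derivative flat (k + 2) t - k * flat (k + 1) t) (at t)"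
    proof (cases k)
      case 0
      with 3 show ?thesis
        by (auto intro!: derivative_eq_intros simp: flat_def field_simps power2_eq_square)
    next
      case (Suc n)
      with 3 show ?thesis
        by (auto intro!: derivative_eq_intros
            simp: flat_def field_simps power2_eq_square power_eq_if[of t n])
    qed
    then show ?thesis
      by (rule has_field_derivative_transform_within_open[of _ _ _ "{0<..}"])
        (use 3 in \<open>auto simp: flat_def\<close>)
  qed
qed

lemma has_derivative_flat_comp:
  assumes "((\<lambda>x. complex_of_real (p x)) has_derivative D) (at x)"
  shows "((\<lambda>x. complex_of_real (flat k (p x))) has_derivative
    (\<lambda>h. of_real (flat (k + 2) (p x) - k * flat (k + 1) (p x)) * D h)) (at x)"
proof -
  have "((\<lambda>x. Re (complex_of_real (p x))) has_derivative (\<lambda>h. Re (D h))) (at x)"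
    using assms by (rule bounded_linear.has_derivative[OF bounded_linear_Re])
  then have p: "(p has_derivative (\<lambda>h. Re (D h))) (at x)"
    by simp
  have "((\<lambda>x. complex_of_real (p x)) has_derivative (\<lambda>h. of_real (Re (D h)))) (at x)"
    using p by (rule bounded_linear.has_derivative[OF bounded_linear_of_real])
  \<comment> \<open>Since \<open>smooth\<close> concerns complex functions, the real function
    \<open>p\<close> enters through its embedding; uniqueness of the derivative shows that
    \<open>D\<close> is real-valued.\<close>
  then have D: "D = (\<lambda>h. of_real (Re (D h)))"
    using assms has_derivative_unique by blast
  have "((\<lambda>x. flat k (p x)) has_derivative
      (\<lambda>h. Re (D h) * (flat (k + 2) (p x) - k * flat (k + 1) (p x)))) (at x)"
    using has_derivative_compose[OF p DERIV_flat[of k "p x", unfolded has_field_derivative_def]]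
    by (simp add: mult.commute)
  then have "((\<lambda>x. complex_of_real (flat k (p x))) has_derivative
      (\<lambda>h. of_real (Re (D h) * (flat (k + 2) (p x) - k * flat (k + 1) (p x))))) (at x)"
    by (rule bounded_linear.has_derivative[OF bounded_linear_of_real])
  then show ?thesis
    by (subst D) (simp add: mult.commute)
qed

text \<open>Membership in this class is stable under partial derivatives by the sum, product and chain
  rules, so that \<open>smooth_coinduct\<close> yields all the closure properties at once.\<close>

inductive smooth_generated :: "('a::euclidean_space \<Rightarrow> complex) \<Rightarrow> bool" where
  affine: "smooth f \<Longrightarrow> smooth_generated (\<lambda>x. f (c *\<^sub>R x + a))"
| cnj: "smooth f \<Longrightarrow> smooth_generated (\<lambda>x. cnj (f x))"
| add: "smooth_generated f \<Longrightarrow> smooth_generated g \<Longrightarrow> smooth_generated (\<lambda>x. f x + g x)"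
| mult: "smooth_generated f \<Longrightarrow> smooth_generated g \<Longrightarrow> smooth_generated (\<lambda>x. f x * g x)"
| flat: "smooth (\<lambda>x. complex_of_real (p x)) \<Longrightarrow> smooth_generated (\<lambda>x. complex_of_real (flat k (p x)))"

lemma smooth_generated_base: "smooth f \<Longrightarrow> smooth_generated f"
  using smooth_generated.affine[of f 1 0] by simp

lemma smooth_generated_differentiable: "smooth_generated f \<Longrightarrow> f differentiable (at x)"
proof (induction rule: smooth_generated.induct)
  case (affine f c a)
  then show ?case
    using smooth_differentiable[of f] has_derivative_affine_comp[of f _ c x a]
    unfolding differentiable_def by metis
next
  case (cnj f)
  then show ?case
    using smooth_differentiable[of f] bounded_linear.has_derivative[OF bounded_linear_cnj]
    unfolding differentiable_def by metis
next
  case (flat p k)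
  then obtain D where "((\<lambda>x. complex_of_real (p x)) has_derivative D) (at x)"
    using smooth_differentiable unfolding differentiable_def by metis
  then show ?case
    using has_derivative_flat_comp unfolding differentiable_def by blast
qed (auto intro: differentiable_add differentiable_mult)

lemma smooth_generated_partial_deriv:
  assumes "smooth_generated f" "b \<in> Basis"
  shows "smooth_generated (partial_deriv b f)"
  using assms
proof (induction rule: smooth_generated.induct)
  case (affine f c a)
  then show ?case
    by (simp add: partial_deriv_affine smooth_differentiable smooth_generated.mult
        smooth_generated.affine smooth_partial_deriv smooth_generated_base[OF smooth_const])
next
  case (cnj f)
  then show ?case
    by (auto simp: partial_deriv_cnj smooth_differentiable smooth_partial_deriv intro: smooth_generated.cnj)
next
  case (flat p k)
  have "partial_deriv b (\<lambda>x. complex_of_real (flat k (p x))) =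
      (\<lambda>x. (of_real (flat (k + 2) (p x)) + (- of_nat k) * of_real (flat (k + 1) (p x))) *
        partial_deriv b (\<lambda>x. complex_of_real (p x)) x)"
  proof
    fix x
    obtain D where D: "((\<lambda>x. complex_of_real (p x)) has_derivative D) (at x)"
      using flat smooth_differentiable unfolding differentiable_def by metis
    show "partial_deriv b (\<lambda>x. complex_of_real (flat k (p x))) x =
      (of_real (flat (k + 2) (p x)) + (- of_nat k) * of_real (flat (k + 1) (p x))) *
        partial_deriv b (\<lambda>x. complex_of_real (p x)) x"
      using partial_deriv_eq[OF D, of b] partial_deriv_eq[OF has_derivative_flat_comp[OF D], of b]
      by simp
  qed
  moreover have "smooth (partial_deriv b (\<lambda>x. complex_of_real (p x)))"
    using flat by (intro smooth_partial_deriv)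
  ultimately show ?case
    using smooth_generated.mult[OF smooth_generated.add[OF smooth_generated.flat
          smooth_generated.mult[OF smooth_generated_base[OF smooth_const] smooth_generated.flat]]
        smooth_generated_base, of p p "partial_deriv b (\<lambda>x. complex_of_real (p x))"] flat
    by (simp only:)
qed (auto simp: partial_deriv_add partial_deriv_mult smooth_generated_differentiable
    intro: smooth_generated.intros)

lemma smooth_generated_smooth: "smooth_generated f \<Longrightarrow> smooth f"
  by (rule smooth_coinduct[where P=smooth_generated])
    (auto intro: smooth_generated_differentiable smooth_generated_partial_deriv)

lemma smooth_affine: "smooth f \<Longrightarrow> smooth (\<lambda>x. f (c *\<^sub>R x + a))"
  and smooth_cnj: "smooth f \<Longrightarrow> smooth (\<lambda>x. cnj (f x))"
  and smooth_flat: "smooth (\<lambda>x. complex_of_real (p x)) \<Longrightarrow> smooth (\<lambda>x. complex_of_real (flat k (p x)))"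
  by (auto intro: smooth_generated_smooth smooth_generated.intros)

lemma smooth_add: "smooth f \<Longrightarrow> smooth g \<Longrightarrow> smooth (\<lambda>x. f x + g x)"
  and smooth_mult: "smooth f \<Longrightarrow> smooth g \<Longrightarrow> smooth (\<lambda>x. f x * g x)"
  by (auto intro: smooth_generated_smooth smooth_generated.intros smooth_generated_base)

lemma smooth_diff: "smooth f \<Longrightarrow> smooth g \<Longrightarrow> smooth (\<lambda>x. f x - g x)"
  using smooth_add[OF _ smooth_mult[OF smooth_const[of "-1"]], of f g] by simp

lemma smooth_sum: "(\<And>i. i \<in> I \<Longrightarrow> smooth (f i)) \<Longrightarrow> smooth (\<lambda>x. \<Sum>i\<in>I. f i x)"
  by (induction I rule: infinite_finite_induct) (auto intro: smooth_add)

lemma smooth_prod: "(\<And>i. i \<in> I \<Longrightarrow> smooth (f i)) \<Longrightarrow> smooth (\<lambda>x. \<Prod>i\<in>I. f i x)"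
  by (induction I rule: infinite_finite_induct) (auto intro: smooth_mult)

lemma smooth_norm_square: "smooth (\<lambda>x::'a::euclidean_space. complex_of_real ((norm x)\<^sup>2))"
proof -
  have "complex_of_real ((norm x)\<^sup>2) = (\<Sum>b\<in>Basis. of_real (x \<bullet> b) * of_real (x \<bullet> b))" for x :: 'a
    by (subst power2_norm_eq_inner, subst euclidean_inner) simp
  then show ?thesis
    by (auto intro!: smooth_sum smooth_mult smooth_inner)
qed

lemma smooth_continuous_on: "smooth f \<Longrightarrow> continuous_on S f"
  using smooth_differentiable
  by (intro continuous_at_imp_continuous_on ballI differentiable_imp_continuous_within) auto

section \<open>Rules for the Laplacian\<close>

lemma smooth_neg_laplacian: "smooth f \<Longrightarrow> smooth (neg_laplacian f)"
  unfolding neg_laplacian_def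
  using smooth_mult[OF smooth_const[of "-1"] smooth_sum, of Basis "\<lambda>b x. partial_deriv b (partial_deriv b f) x"]
  by (simp add: smooth_partial_deriv)

lemma neg_laplacian_add:
  assumes "smooth f" "smooth g"
  shows "neg_laplacian (\<lambda>x. f x + g x) = (\<lambda>x. neg_laplacian f x + neg_laplacian g x)"
proof -
  have "partial_deriv b (partial_deriv b (\<lambda>x. f x + g x)) =
      (\<lambda>x. partial_deriv b (partial_deriv b f) x + partial_deriv b (partial_deriv b g) x)"
    if "b \<in> Basis" for b
    using assms that by (simp add: partial_deriv_add smooth_differentiable smooth_partial_deriv)
  then show ?thesis
    by (simp add: neg_laplacian_def fun_eq_iff sum.distrib)
qed

lemma neg_laplacian_cmult:
  assumes "smooth f"
  shows "neg_laplacian (\<lambda>x. c * f x) = (\<lambda>x. c * neg_laplacian f x)"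
proof -
  have "partial_deriv b (partial_deriv b (\<lambda>x. c * f x)) =
      (\<lambda>x. c * partial_deriv b (partial_deriv b f) x)"
    if "b \<in> Basis" for b
    using assms that by (simp add: partial_deriv_cmult smooth_differentiable smooth_partial_deriv)
  then show ?thesis
    by (simp add: neg_laplacian_def fun_eq_iff sum_distrib_left)
qed

lemma neg_laplacian_mult:
  assumes "smooth f" "smooth g"
  shows "neg_laplacian (\<lambda>x. f x * g x) = (\<lambda>x. f x * neg_laplacian g x + g x * neg_laplacian f x
    - 2 * (\<Sum>b\<in>Basis. partial_deriv b f x * partial_deriv b g x))"
proof -
  have "partial_deriv b (partial_deriv b (\<lambda>x. f x * g x)) =
      (\<lambda>x. f x * partial_deriv b (partial_deriv b g) x + g x * partial_deriv b (partial_deriv b f) x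
        + 2 * (partial_deriv b f x * partial_deriv b g x))" if "b \<in> Basis" for b
    using assms that
    by (simp add: partial_deriv_mult partial_deriv_add smooth_differentiable smooth_partial_deriv
        smooth_mult fun_eq_iff algebra_simps)
  then show ?thesis
    by (simp add: neg_laplacian_def fun_eq_iff sum.distrib sum_distrib_left sum_negf)
qed

lemma neg_laplacian_affine:
  assumes "smooth f"
  shows "neg_laplacian (\<lambda>x. f (c *\<^sub>R x + a)) = (\<lambda>x. of_real (c\<^sup>2) * neg_laplacian f (c *\<^sub>R x + a))"
proof -
  have "partial_deriv b (partial_deriv b (\<lambda>x. f (c *\<^sub>R x + a))) =
      (\<lambda>x. of_real (c\<^sup>2) * partial_deriv b (partial_deriv b f) (c *\<^sub>R x + a))" if "b \<in> Basis" for b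
    using assms that smooth_affine[OF smooth_partial_deriv[OF assms that]]
    by (simp add: partial_deriv_affine partial_deriv_cmult smooth_differentiable smooth_partial_deriv
        fun_eq_iff power2_eq_square mult.assoc)
  then show ?thesis
    by (simp add: neg_laplacian_def fun_eq_iff sum_distrib_left)
qed

section \<open>Test functions\<close>

text \<open>Any compact set off which \<open>f\<close> vanishes can stand in for the support, which
  is a closed subset of it. This spares computing supports exactly.\<close>

lemma C_c_infinityI:
  assumes "smooth f" "compact K" "K \<subseteq> U" "\<And>x. x \<notin> K \<Longrightarrow> f x = 0"
  shows "f \<in> C_c_infinity U"
proof -
  have "closure {x. f x \<noteq> 0} \<subseteq> K"
    using assms by (intro closure_minimal) (auto simp: compact_imp_closed)
  then show ?thesis
    using assms(1-3) compact_Int_closed[of K "closure {x. f x \<noteq> 0}"]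
    by (auto simp: C_c_infinity_def Int_absorb1)
qed

lemma C_c_infinityE:
  assumes "f \<in> C_c_infinity U"
  obtains K where "smooth f" "compact K" "K \<subseteq> U" "\<And>x. x \<notin> K \<Longrightarrow> f x = 0"
  using assms closure_subset[of "{x. f x \<noteq> 0}"]
  by (auto simp: C_c_infinity_def intro: that[of "closure {x. f x \<noteq> 0}"])

lemma C_c_infinity_smooth: "f \<in> C_c_infinity U \<Longrightarrow> smooth f"
  by (simp add: C_c_infinity_def)

lemma C_c_infinity_UNIV: "f \<in> C_c_infinity U \<Longrightarrow> f \<in> C_c_infinity UNIV"
  by (simp add: C_c_infinity_def)

lemma C_c_infinity_square_integrable: "f \<in> C_c_infinity U \<Longrightarrow> square_integrable f"
  by (rule square_integrable_test_function)

lemma C_c_infinity_zero: "(\<lambda>x. 0) \<in> C_c_infinity U"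
  by (rule C_c_infinityI[of _ "{}"]) auto

lemma C_c_infinity_add:
  assumes "f \<in> C_c_infinity U" "g \<in> C_c_infinity U"
  shows "(\<lambda>x. f x + g x) \<in> C_c_infinity U"
proof -
  obtain K K' where "compact K" "K \<subseteq> U" "\<And>x. x \<notin> K \<Longrightarrow> f x = 0"
    "compact K'" "K' \<subseteq> U" "\<And>x. x \<notin> K' \<Longrightarrow> g x = 0"
    using assms by (elim C_c_infinityE) metis
  then show ?thesis
    using assms
    by (intro C_c_infinityI[of _ "K \<union> K'"]) (auto intro: smooth_add C_c_infinity_smooth compact_Un)
qed

lemma C_c_infinity_mult:
  assumes "f \<in> C_c_infinity U" "smooth g"
  shows "(\<lambda>x. g x * f x) \<in> C_c_infinity U"
  using assms by (elim C_c_infinityE) (auto intro: C_c_infinityI smooth_mult)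

lemma C_c_infinity_translate:
  fixes a :: "'a::euclidean_space"
  assumes "f \<in> C_c_infinity UNIV"
  shows "(\<lambda>x. f (x - a)) \<in> C_c_infinity UNIV"
proof -
  obtain K where K: "smooth f" "compact K" "\<And>x. x \<notin> K \<Longrightarrow> f x = 0"
    using assms by (elim C_c_infinityE) metis
  show ?thesis
  proof (rule C_c_infinityI)
    show "smooth (\<lambda>x. f (x - a))"
      using smooth_affine[OF K(1), of 1 "- a"] by simp
    show "compact ((+) a ` K)"
      using K(2) by (rule compact_translation)
    show "f (x - a) = 0" if "x \<notin> (+) a ` K" for x
      using that K(3)[of "x - a"] by (force simp: image_iff)
  qed simp
qed

lemma C_c_infinity_partial_deriv:
  assumes "f \<in> C_c_infinity U" "b \<in> Basis"
  shows "partial_deriv b f \<in> C_c_infinity U"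
proof -
  obtain K where K: "smooth f" "compact K" "K \<subseteq> U" "\<And>x. x \<notin> K \<Longrightarrow> f x = 0"
    using assms(1) by (rule C_c_infinityE) blast
  have "partial_deriv b f x = 0" if "x \<notin> K" for x
    using partial_deriv_eq_0_outside[OF compact_imp_closed[OF K(2)]] K(4) that by blast
  then show ?thesis
    using K assms by (intro C_c_infinityI[of _ K]) (auto intro: smooth_partial_deriv)
qed


section \<open>Integration against test functions\<close>

text \<open>One majorant records both the supremum and the extent of the support, in the shape that
  dominated convergence asks for.\<close>

lemma C_c_infinity_bounded:
  fixes f :: "'a::euclidean_space \<Rightarrow> complex"
  assumes "f \<in> C_c_infinity U"
  obtains B R where "B \<ge> 0" "R \<ge> 0" "\<And>x. cmod (f x) \<le> B * indicator (cball 0 R) x"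
proof -
  obtain K where K: "smooth f" "compact K" "\<And>x. x \<notin> K \<Longrightarrow> f x = 0"
    using assms by (elim C_c_infinityE) metis
  then have "bounded (f ` K)"
    by (intro compact_imp_bounded compact_continuous_image smooth_continuous_on)
  then obtain B where B: "\<And>x. x \<in> K \<Longrightarrow> cmod (f x) \<le> B"
    unfolding bounded_iff by auto
  obtain R where R: "\<And>x. x \<in> K \<Longrightarrow> norm x \<le> R"
    using compact_imp_bounded[OF K(2)] unfolding bounded_iff by auto
  show ?thesis
  proof (rule that[of "max 0 B" "max 0 R"])
    show "cmod (f x) \<le> max 0 B * indicator (cball 0 (max 0 R)) x" for x
      using B[of x] R[of x] K(3)[of x] by (cases "x \<in> K") (auto simp: indicator_def)
  qed auto
qed

text \<open>A common home for the constant 1, which turns pairings into plain integrals, and for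
  square-integrable functions. Centred balls suffice since every bounded set lies in one.\<close>

definition local_L1 :: "('a::euclidean_space \<Rightarrow> complex) \<Rightarrow> bool" where
  "local_L1 h \<longleftrightarrow> h \<in> borel_measurable borel \<and>
     (\<forall>R. integrable lborel (\<lambda>x. indicator (cball 0 R) x * cmod (h x)))"

lemma integrable_indicator_cball:
  "integrable lborel (indicator (cball 0 R) :: 'a::euclidean_space \<Rightarrow> real)"
  using emeasure_lborel_cball_finite[of 0 R] by (intro integrable_real_indicator) auto

lemma local_L1_const: "local_L1 (\<lambda>x. c)"
  unfolding local_L1_def using integrable_indicator_cball by auto

lemma local_L1_square_integrable:
  assumes "square_integrable h"
  shows "local_L1 h"
proof -
  have h[measurable]: "h \<in> borel_measurable borel" and "integrable lborel (\<lambda>x. (cmod (h x))\<^sup>2)"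
    using assms by (auto simp: square_integrable_def)
  have [measurable]: "cball (0 :: 'a) R \<in> sets borel" for R
    by simp
  have "integrable lborel (\<lambda>x. indicator (cball 0 R) x * cmod (h x))" for R
  proof (rule Bochner_Integration.integrable_bound)
    show "integrable lborel (\<lambda>x. indicator (cball 0 R) x + (cmod (h x))\<^sup>2)"
      by (intro Bochner_Integration.integrable_add integrable_indicator_cball) fact
    have "indicator (cball 0 R) x * cmod (h x) \<le> indicator (cball 0 R) x + (cmod (h x))\<^sup>2" for x
      using sum_squares_bound[of 1 "cmod (h x)"]
      by (auto simp: indicator_def) (smt (verit) norm_ge_zero)
    then show "AE x in lborel. norm (indicator (cball 0 R) x * cmod (h x))
        \<le> norm (indicator (cball 0 R) x + (cmod (h x))\<^sup>2)"
      by (intro AE_I2) (auto simp: abs_mult)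
  qed measurable
  then show ?thesis
    by (simp add: local_L1_def h)
qed

lemma local_L1_dominated:
  assumes h: "local_L1 h"
    and [measurable]: "\<And>n. g n \<in> borel_measurable borel" "G \<in> borel_measurable borel"
    and bound: "\<And>n x. cmod (g n x) \<le> B * indicator (cball 0 R) x"
    and lim: "AE x in lborel. (\<lambda>n::nat. g n x) \<longlonglongrightarrow> G x"
  shows "(\<lambda>n. \<integral>x. g n x * h x \<partial>lborel) \<longlonglongrightarrow> (\<integral>x. G x * h x \<partial>lborel)"
proof (rule integral_dominated_convergence)
  have [measurable]: "h \<in> borel_measurable borel"
    using h by (simp add: local_L1_def)
  show "(\<lambda>x. G x * h x) \<in> borel_measurable lborel" "\<And>n. (\<lambda>x. g n x * h x) \<in> borel_measurable lborel"
    by measurable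
  show "integrable lborel (\<lambda>x. B * (indicator (cball 0 R) x * cmod (h x)))"
    using h by (simp add: local_L1_def)
  show "AE x in lborel. (\<lambda>n. g n x * h x) \<longlonglongrightarrow> G x * h x"
    using lim by eventually_elim (intro tendsto_intros)
  show "AE x in lborel. norm (g n x * h x) \<le> B * (indicator (cball 0 R) x * cmod (h x))" for n
    using mult_right_mono[OF bound norm_ge_zero]
    by (intro AE_I2) (auto simp: norm_mult mult.assoc)
qed

lemma C_c_infinity_measurable: "f \<in> C_c_infinity U \<Longrightarrow> f \<in> borel_measurable borel"
  by (intro borel_measurable_continuous_onI smooth_continuous_on C_c_infinity_smooth)

lemma local_L1_integrable:
  fixes h :: "'a::euclidean_space \<Rightarrow> complex"
  assumes h: "local_L1 h" and f: "f \<in> C_c_infinity U"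
  shows "integrable lborel (\<lambda>x. f x * h x)"
proof -
  obtain B R where B: "\<And>x. cmod (f x) \<le> B * indicator (cball 0 R) x"
    using C_c_infinity_bounded[OF f] by metis
  have [measurable]: "h \<in> borel_measurable borel" "f \<in> borel_measurable borel"
    using h f by (simp_all add: local_L1_def C_c_infinity_measurable)
  show ?thesis
  proof (rule Bochner_Integration.integrable_bound)
    show "integrable lborel (\<lambda>x. B * (indicator (cball 0 R) x * cmod (h x)))"
      using h by (simp add: local_L1_def)
    have "norm (f x * h x) \<le> B * (indicator (cball 0 R) x * cmod (h x))" for x
      using mult_right_mono[OF B norm_ge_zero, of x "h x"] by (simp add: norm_mult mult.assoc)
    then show "AE x in lborel. norm (f x * h x) \<le> norm (B * (indicator (cball 0 R) x * cmod (h x)))"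
      by (intro AE_I2) (smt (verit) real_norm_def)
  qed measurable
qed

lemma C_c_infinity_difference_bound:
  fixes g :: "'a::euclidean_space \<Rightarrow> complex"
  assumes g: "g \<in> C_c_infinity U" and b: "b \<in> Basis"
  obtains B where "B \<ge> 0" "\<And>x t. cmod (g (x + t *\<^sub>R b) - g x) \<le> B * \<bar>t\<bar>"
proof -
  obtain B R where B: "B \<ge> 0" "\<And>x. cmod (partial_deriv b g x) \<le> B * indicator (cball 0 R) x"
    using C_c_infinity_bounded[OF C_c_infinity_partial_deriv[OF g b]] by metis
  have B': "cmod (partial_deriv b g x) \<le> B" for x
    using B(2)[of x] B(1) by (cases "norm x \<le> R") auto
  have "cmod (g (x + t *\<^sub>R b) - g (x + 0 *\<^sub>R b)) \<le> B * norm (t - 0)" for x t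
  proof (rule differentiable_bound[of UNIV])
    show "((\<lambda>t. g (x + t *\<^sub>R b)) has_derivative (\<lambda>s. s *\<^sub>R partial_deriv b g (x + t *\<^sub>R b)))
        (at t within UNIV)" for t
      using has_vector_derivative_partial_deriv[of g x t b] smooth_differentiable[OF C_c_infinity_smooth[OF g]]
      by (simp add: has_vector_derivative_def)
    show "onorm (\<lambda>s. s *\<^sub>R partial_deriv b g (x + t *\<^sub>R b)) \<le> B" for t
      using mult_left_mono[OF B' abs_ge_zero] by (intro onorm_bound) (auto simp: B mult.commute[of B])
  qed auto
  then show ?thesis
    using B(1) by (intro that[of B]) auto
qed

text \<open>The mean value inequality bounds the quotients, and boundedness of the steps keeps all
  supports in one ball, so dominated convergence applies. With \<open>h\<close> constant this
  computes integrals of derivatives; with general \<open>h\<close> it differentiates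
  correlations.\<close>

lemma difference_quotient_tendsto:
  fixes g h :: "'a::euclidean_space \<Rightarrow> complex"
  assumes h: "local_L1 h" and g: "g \<in> C_c_infinity U" and b: "b \<in> Basis"
    and s: "s \<longlonglongrightarrow> 0" "\<And>n. s n \<noteq> (0::real)"
  shows "(\<lambda>n. \<integral>y. (g (y + s n *\<^sub>R b) - g y) / of_real (s n) * h y \<partial>lborel)
    \<longlonglongrightarrow> (\<integral>y. partial_deriv b g y * h y \<partial>lborel)"
proof -
  have cont: "continuous_on S g" "continuous_on S (partial_deriv b g)" for S
    using C_c_infinity_smooth[OF g] b
    by (auto intro!: smooth_continuous_on smooth_partial_deriv)
  have [measurable]: "g \<in> borel_measurable borel" "partial_deriv b g \<in> borel_measurable borel"
    using cont by (auto intro: borel_measurable_continuous_onI)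
  obtain B where B: "B \<ge> 0" "\<And>x t. cmod (g (x + t *\<^sub>R b) - g x) \<le> B * \<bar>t\<bar>"
    using C_c_infinity_difference_bound[OF g b] by blast
  obtain A R where R: "\<And>x. cmod (g x) \<le> A * indicator (cball 0 R) x"
    using C_c_infinity_bounded[OF g] by metis
  have g0: "g x = 0" if "norm x > R" for x
    using R[of x] that by (simp add: indicator_def)
  obtain T where T: "\<And>n. \<bar>s n\<bar> \<le> T"
    using convergent_imp_Bseq[of s] s(1) by (auto simp: convergent_def Bseq_def)
  show ?thesis
  proof (rule local_L1_dominated[OF h])
    show "cmod ((g (y + s n *\<^sub>R b) - g y) / of_real (s n)) \<le> B * indicator (cball 0 (R + T)) y" for n y
    proof (cases "norm y \<le> R + T")
      case True
      then show ?thesis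
        using B(2)[of y "s n"] s(2)[of n] by (simp add: norm_divide field_simps)
    next
      case False
      have "norm y \<le> norm (y + s n *\<^sub>R b) + \<bar>s n\<bar>"
        using norm_triangle_ineq4[of "y + s n *\<^sub>R b" "s n *\<^sub>R b"] b by simp
      then have "g (y + s n *\<^sub>R b) = 0" "g y = 0"
        using False T[of n] by (auto intro!: g0)
      then show ?thesis
        using B(1) by simp
    qed
    have "(\<lambda>n. (g (y + s n *\<^sub>R b) - g y) / of_real (s n)) \<longlonglongrightarrow> partial_deriv b g y" for y
    proof -
      have "((\<lambda>t. g (y + t *\<^sub>R b)) has_vector_derivative partial_deriv b g y) (at 0)"
        using has_vector_derivative_partial_deriv[of g y 0 b]
          smooth_differentiable[OF C_c_infinity_smooth[OF g]] by simp
      then have "((\<lambda>t. norm (g (y + t *\<^sub>R b) - g y - t *\<^sub>R partial_deriv b g y) / norm t) \<longlongrightarrow> 0) (at 0)"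
        by (simp add: has_vector_derivative_def has_derivative_at)
      then have "(\<lambda>n. norm (g (y + s n *\<^sub>R b) - g y - s n *\<^sub>R partial_deriv b g y) / norm (s n)) \<longlonglongrightarrow> 0"
        by (rule filterlim_compose) (use s in \<open>auto simp: filterlim_at\<close>)
      moreover have "norm (g (y + s n *\<^sub>R b) - g y - s n *\<^sub>R partial_deriv b g y) / norm (s n)
          = norm ((g (y + s n *\<^sub>R b) - g y) / of_real (s n) - partial_deriv b g y)" for n
      proof -
        have "(g (y + s n *\<^sub>R b) - g y) / of_real (s n) - partial_deriv b g y
            = (g (y + s n *\<^sub>R b) - g y - s n *\<^sub>R partial_deriv b g y) / of_real (s n)"
          using s(2)[of n] by (simp add: diff_divide_distrib scaleR_conv_of_real)
        then show ?thesis
          by (simp add: norm_divide)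
      qed
      ultimately have "(\<lambda>n. norm ((g (y + s n *\<^sub>R b) - g y) / of_real (s n) - partial_deriv b g y)) \<longlonglongrightarrow> 0"
        by simp
      then show ?thesis
        by (rule LIM_zero_cancel[OF tendsto_norm_zero_cancel])
    qed
    then show "AE y in lborel. (\<lambda>n. (g (y + s n *\<^sub>R b) - g y) / of_real (s n)) \<longlonglongrightarrow> partial_deriv b g y"
      by simp
  qed measurable
qed

section \<open>Translation invariance and integration by parts\<close>

lemma integral_translate:
  fixes f :: "'a::euclidean_space \<Rightarrow> 'b::{banach, second_countable_topology}"
  assumes "f \<in> borel_measurable borel"
  shows "(\<integral>x. f (x + c) \<partial>lborel) = (\<integral>x. f x \<partial>lborel)"
proof -
  have "(\<integral>x. f x \<partial>lborel) = (\<integral>x. f x \<partial>distr lborel borel ((+) c))"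
    by (simp add: lborel_distr_plus)
  also have "\<dots> = (\<integral>x. f (c + x) \<partial>lborel)"
    using assms by (intro integral_distr) auto
  finally show ?thesis
    by (simp add: add.commute)
qed

text \<open>By translation invariance every difference quotient of \<open>g\<close> has integral
  zero, and the limit inherits this; no iterated integral is involved. The factor 1 is the constant
  function in the role of \<open>h\<close>.\<close>

lemma integral_partial_deriv:
  assumes g: "g \<in> C_c_infinity U" and b: "b \<in> Basis"
  shows "(\<integral>y. partial_deriv b g y \<partial>lborel) = 0"
proof -
  have lim: "(\<lambda>n. \<integral>y. (g (y + inverse (real (Suc n)) *\<^sub>R b) - g y) / of_real (inverse (real (Suc n))) * 1 \<partial>lborel)
    \<longlonglongrightarrow> (\<integral>y. partial_deriv b g y * 1 \<partial>lborel)"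
    by (intro difference_quotient_tendsto[OF local_L1_const g b] LIMSEQ_inverse_real_of_nat) auto
  have g': "(\<lambda>y. g (y + c)) \<in> C_c_infinity UNIV" for c
    using C_c_infinity_translate[OF C_c_infinity_UNIV[OF g], of "- c"] by simp
  have int: "integrable lborel (\<lambda>y. g (y + c))" for c
    using local_L1_integrable[OF local_L1_const[of 1] g', of c] by simp
  have "(\<integral>y. (g (y + c) - g y) / a * 1 \<partial>lborel) = 0" for a c
    using int[of c] int[of 0] integral_translate[OF C_c_infinity_measurable[OF g], of c] by simp
  with lim have "(\<lambda>n. 0) \<longlonglongrightarrow> (\<integral>y. partial_deriv b g y * 1 \<partial>lborel)"
    by (simp only:)
  then show ?thesis
    by (simp add: LIMSEQ_const_iff)
qed

lemma C_c_infinity_cnj: "f \<in> C_c_infinity U \<Longrightarrow> (\<lambda>x. cnj (f x)) \<in> C_c_infinity U"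
  by (elim C_c_infinityE) (auto intro: C_c_infinityI smooth_cnj)

lemma integral_by_parts:
  assumes f: "f \<in> C_c_infinity U" and g: "g \<in> C_c_infinity V" and b: "b \<in> Basis"
  shows "(\<integral>y. partial_deriv b f y * g y \<partial>lborel) = - (\<integral>y. f y * partial_deriv b g y \<partial>lborel)"
proof -
  note sm = C_c_infinity_smooth[OF f] C_c_infinity_smooth[OF g]
  have "integrable lborel (\<lambda>y. partial_deriv b f y * g y)" "integrable lborel (\<lambda>y. f y * partial_deriv b g y)"
    using f g b
    by (auto intro!: local_L1_integrable local_L1_square_integrable C_c_infinity_square_integrable
        C_c_infinity_partial_deriv)
  moreover have "(\<integral>y. partial_deriv b f y * g y + f y * partial_deriv b g y \<partial>lborel) = 0"
    using integral_partial_deriv[OF C_c_infinity_mult[OF g sm(1)] b] sm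
    by (simp add: partial_deriv_mult smooth_differentiable)
  ultimately show ?thesis
    by (simp add: eq_neg_iff_add_eq_0)
qed

lemma neg_laplacian_C_c_infinity:
  assumes "f \<in> C_c_infinity U"
  shows "neg_laplacian f \<in> C_c_infinity U"
proof -
  obtain K where K: "smooth f" "compact K" "K \<subseteq> U" "\<And>x. x \<notin> K \<Longrightarrow> f x = 0"
    using assms by (rule C_c_infinityE) blast
  note K0 = partial_deriv_eq_0_outside[OF compact_imp_closed[OF K(2)]]
  have "neg_laplacian f x = 0" if "x \<notin> K" for x
    unfolding neg_laplacian_def using K0[OF K0[OF K(4)] that] by simp
  then show ?thesis
    using K by (intro C_c_infinityI[of _ K]) (auto intro: smooth_neg_laplacian)
qed

text \<open>The right-hand side is Hermitian in \<open>f\<close> and \<open>g\<close>, and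
  nonnegative for \<open>f = g\<close>; it delivers both symmetry and nonnegativity of the
  operator.\<close>

lemma Green_identity:
  assumes f: "f \<in> C_c_infinity U" and g: "g \<in> C_c_infinity V"
  shows "(\<integral>x. neg_laplacian f x * cnj (g x) \<partial>lborel)
    = (\<Sum>b\<in>Basis. \<integral>x. partial_deriv b f x * cnj (partial_deriv b g x) \<partial>lborel)"
proof -
  have int: "integrable lborel (\<lambda>x. partial_deriv b (partial_deriv b f) x * cnj (g x))" if "b \<in> Basis" for b
    using f g that
    by (auto intro!: local_L1_integrable local_L1_square_integrable C_c_infinity_square_integrable
        C_c_infinity_partial_deriv C_c_infinity_cnj)
  have "(\<integral>x. neg_laplacian f x * cnj (g x) \<partial>lborel)
    = - (\<Sum>b\<in>Basis. \<integral>x. partial_deriv b (partial_deriv b f) x * cnj (g x) \<partial>lborel)"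
    using int by (simp add: neg_laplacian_def sum_distrib_right Bochner_Integration.integral_sum)
  also have "\<dots> = (\<Sum>b\<in>Basis. \<integral>x. partial_deriv b f x * cnj (partial_deriv b g x) \<partial>lborel)"
    unfolding sum_negf[symmetric]
  proof (rule sum.cong)
    fix b :: 'a
    assume b: "b \<in> Basis"
    show "- (\<integral>x. partial_deriv b (partial_deriv b f) x * cnj (g x) \<partial>lborel)
        = (\<integral>x. partial_deriv b f x * cnj (partial_deriv b g x) \<partial>lborel)"
      using integral_by_parts[OF C_c_infinity_partial_deriv[OF f b] C_c_infinity_cnj[OF g] b]
      by (simp add: partial_deriv_cnj smooth_differentiable C_c_infinity_smooth[OF g])
  qed simp
  finally show ?thesis .
qed

section \<open>A Liouville theorem\<close>

text \<open>If \<open>D\<close> were positive, \<open>F'\<close> would be positive just to the right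
  of its zero at 0, and the mean value theorem would give a value above \<open>F 0\<close>.\<close>

lemma second_derivative_at_maximum:
  fixes F F' :: "real \<Rightarrow> real"
  assumes F: "\<And>t. (F has_real_derivative F' t) (at t)" and F': "(F' has_real_derivative D) (at 0)"
    and max: "\<And>t. F t \<le> F 0"
  shows "D \<le> 0"
proof (rule ccontr)
  assume "\<not> D \<le> 0"
  then obtain d where d: "d > 0" "\<And>h. 0 < h \<Longrightarrow> h < d \<Longrightarrow> F' 0 < F' (0 + h)"
    using DERIV_pos_inc_right[OF F'] by auto
  have "F' 0 = 0"
    using DERIV_local_max[OF F zero_less_one] max by blast
  obtain z where "0 < z" "z < d / 2" "F (d / 2) - F 0 = (d / 2 - 0) * F' z"
    using MVT2[of 0 "d / 2" F F'] F d(1) by auto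
  moreover from this have "d / 2 * F' z > 0"
    using d(2)[of z] \<open>F' 0 = 0\<close> d(1) by (auto intro!: mult_pos_pos)
  ultimately show False
    using max[of "d / 2"] by simp
qed

text \<open>A bounded function on the whole space need not attain its supremum, but after
  subtracting a small multiple of the squared norm it does, once some value is positive. At that
  maximum each second derivative of \<open>w\<close> is at most 2 \<epsilon>, so \<open>w\<close> is
  at most 2 d \<epsilon> there.\<close>

lemma bounded_subsolution_nonpos:
  fixes w :: "'a::euclidean_space \<Rightarrow> real"
  assumes cont: "continuous_on UNIV w" and bound: "\<And>x. w x \<le> M"
    and dw: "\<And>b x t. b \<in> Basis \<Longrightarrow>
      ((\<lambda>t. w (x + t *\<^sub>R b)) has_real_derivative dw b (x + t *\<^sub>R b)) (at t)"
    and ddw: "\<And>b x t. b \<in> Basis \<Longrightarrow>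
      ((\<lambda>t. dw b (x + t *\<^sub>R b)) has_real_derivative ddw b (x + t *\<^sub>R b)) (at t)"
    and eq: "\<And>x. w x \<le> (\<Sum>b\<in>Basis. ddw b x)"
  shows "w z \<le> 0"
proof (rule ccontr)
  assume "\<not> w z \<le> 0"
  define c where "c = (norm z)\<^sup>2 + 2 * DIM('a)"
  \<comment> \<open>Half of the critical value w z / c: any positive \<epsilon> with \<epsilon> * c
    < w z keeps \<phi> z above 2 d \<epsilon>, the bound valid at a maximum.\<close>
  define \<epsilon> where "\<epsilon> = w z / (2 * c)"
  have "c > 0"
    by (auto simp: c_def intro: add_nonneg_pos)
  then have "\<epsilon> > 0"
    using \<open>\<not> w z \<le> 0\<close> by (simp add: \<epsilon>_def)
  have "\<epsilon> * c < w z"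
    using \<open>\<not> w z \<le> 0\<close> \<open>c > 0\<close> by (simp add: \<epsilon>_def)
  define \<phi> where "\<phi> x = w x - \<epsilon> * (norm x)\<^sup>2" for x
  have \<phi>z: "\<phi> z > \<epsilon> * (2 * DIM('a))"
    using \<open>\<epsilon> * c < w z\<close> by (simp add: \<phi>_def c_def algebra_simps)
  \<comment> \<open>Beyond this radius \<epsilon> times the squared norm is at least |M - \<phi> z|,
    so \<phi> cannot exceed \<phi> z there. Adding \<open>norm z\<close> puts \<open>z\<close> into
    the ball.\<close>
  define R where "R = sqrt (\<bar>M - \<phi> z\<bar> / \<epsilon>) + norm z"
  have out: "\<phi> x \<le> \<phi> z" if "norm x > R" for x
  proof -
    have "\<bar>M - \<phi> z\<bar> / \<epsilon> = (sqrt (\<bar>M - \<phi> z\<bar> / \<epsilon>))\<^sup>2"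
      using \<open>\<epsilon> > 0\<close> by simp
    also have "\<dots> \<le> (norm x)\<^sup>2"
      using that \<open>\<epsilon> > 0\<close> norm_ge_zero[of z] unfolding R_def
      by (intro power_mono real_sqrt_ge_zero divide_nonneg_pos) linarith+
    finally have "\<bar>M - \<phi> z\<bar> \<le> \<epsilon> * (norm x)\<^sup>2"
      using \<open>\<epsilon> > 0\<close> by (simp add: field_simps)
    then show ?thesis
      using bound[of x] unfolding \<phi>_def[of x] by linarith
  qed
  have "z \<in> cball 0 R"
    using \<open>\<epsilon> > 0\<close> by (simp add: R_def)
  then have "\<exists>x\<in>cball 0 R. \<forall>y\<in>cball 0 R. \<phi> y \<le> \<phi> x"
    unfolding \<phi>_def
    by (intro continuous_attains_sup continuous_intros continuous_on_subset[OF cont])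
      (blast intro: compact_cball)+
  then obtain x where x: "\<And>y. y \<in> cball 0 R \<Longrightarrow> \<phi> y \<le> \<phi> x"
    by blast
  have max: "\<phi> y \<le> \<phi> x" for y
    using x[OF \<open>z \<in> cball 0 R\<close>] x[of y] out[of y] by (cases "y \<in> cball 0 R") auto
  have "ddw b x - 2 * \<epsilon> \<le> 0" if b: "b \<in> Basis" for b
  proof (rule second_derivative_at_maximum)
    have sq: "(norm (x + t *\<^sub>R b))\<^sup>2 = (norm x)\<^sup>2 + 2 * t * (x \<bullet> b) + t\<^sup>2" for t
      using b unfolding power2_norm_eq_inner
      by (simp add: inner_simps inner_commute power2_eq_square algebra_simps)
    show "((\<lambda>t. \<phi> (x + t *\<^sub>R b)) has_real_derivative
        dw b (x + t *\<^sub>R b) - \<epsilon> * (2 * (x \<bullet> b) + 2 * t)) (at t)" for t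
      unfolding \<phi>_def sq by (auto intro!: derivative_eq_intros dw[OF b])
    show "((\<lambda>t. dw b (x + t *\<^sub>R b) - \<epsilon> * (2 * (x \<bullet> b) + 2 * t)) has_real_derivative
        ddw b x - 2 * \<epsilon>) (at 0)"
      using ddw[OF b, of x 0] by (auto intro!: derivative_eq_intros)
  qed (use max in simp)
  then have "(\<Sum>b\<in>Basis. ddw b x) \<le> (\<Sum>b\<in>(Basis :: 'a set). 2 * \<epsilon>)"
    by (intro sum_mono) simp
  then have "w x \<le> \<epsilon> * (2 * DIM('a))"
    using eq[of x] by (simp add: algebra_simps)
  moreover have "\<phi> x \<le> w x"
    using \<open>\<epsilon> > 0\<close> by (simp add: \<phi>_def)
  ultimately show False
    using max[of z] \<phi>z by linarith
qed

section \<open>Correlation with a test function\<close>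

text \<open>The convolution of \<open>h\<close> with the reflected test function. In this form the
  integrand contains a plain translate of \<open>f\<close>, to which a weak equation applies
  directly.\<close>

definition correlation :: "('a::euclidean_space \<Rightarrow> complex) \<Rightarrow> ('a \<Rightarrow> complex) \<Rightarrow> 'a \<Rightarrow> complex" where
  "correlation h f x = (\<integral>y. f (y - x) * h y \<partial>lborel)"

text \<open>Moving the base point translates the test function, so the derivative falls on
  \<open>f\<close> with a change of sign and \<open>h\<close> needs no regularity. Real parts are
  taken because the maximum principle is about real functions.\<close>

lemma correlation_has_derivative:
  assumes h: "local_L1 h" and f: "f \<in> C_c_infinity UNIV" and b: "b \<in> Basis"
  shows "((\<lambda>t. Re (correlation h f (x + t *\<^sub>R b))) has_real_derivative
    - Re (correlation h (partial_deriv b f) (x + t *\<^sub>R b))) (at t)"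
  unfolding DERIV_def tendsto_at_iff_sequentially
proof (intro allI impI)
  fix X :: "nat \<Rightarrow> real"
  assume X: "\<forall>i. X i \<in> UNIV - {0}" "X \<longlonglongrightarrow> 0"
  let ?C = "\<lambda>s. correlation h f (x + s *\<^sub>R b)"
  define g where "g = (\<lambda>y. f (y - (x + t *\<^sub>R b)))"
  have g: "g \<in> C_c_infinity UNIV"
    unfolding g_def by (rule C_c_infinity_translate[OF f])
  have dg: "partial_deriv b g y = partial_deriv b f (y - (x + t *\<^sub>R b))" for y
    unfolding g_def
    by (subst partial_deriv_translate) (simp_all add: smooth_differentiable[OF C_c_infinity_smooth[OF f]])
  have int: "integrable lborel (\<lambda>y. f (y - a) * h y)" for a
    by (rule local_L1_integrable[OF h C_c_infinity_translate[OF f]])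
  \<comment> \<open>The step for \<open>g\<close> is \<open>- X n\<close>: moving the base point by
    \<open>X n\<close> along \<open>b\<close> shifts the argument of \<open>f\<close> the opposite
    way.\<close>
  have "(\<integral>y. (g (y + (- X n) *\<^sub>R b) - g y) / of_real (- X n) * h y \<partial>lborel)
      = - ((?C (t + X n) - ?C t) / of_real (X n))" for n
  proof -
    have "(g (y + (- X n) *\<^sub>R b) - g y) / of_real (- X n) * h y
        = (f (y - (x + (t + X n) *\<^sub>R b)) * h y - f (y - (x + t *\<^sub>R b)) * h y) / of_real (- X n)" for y
      by (simp add: g_def algebra_simps diff_divide_distrib)
    then have "(\<integral>y. (g (y + (- X n) *\<^sub>R b) - g y) / of_real (- X n) * h y \<partial>lborel)
        = (\<integral>y. (f (y - (x + (t + X n) *\<^sub>R b)) * h y - f (y - (x + t *\<^sub>R b)) * h y) / of_real (- X n) \<partial>lborel)"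
      by (simp only:)
    also have "\<dots> = - ((?C (t + X n) - ?C t) / of_real (X n))"
      using int by (simp add: correlation_def)
    finally show ?thesis .
  qed
  moreover have "(\<lambda>n. \<integral>y. (g (y + (- X n) *\<^sub>R b) - g y) / of_real (- X n) * h y \<partial>lborel)
      \<longlonglongrightarrow> (\<integral>y. partial_deriv b g y * h y \<partial>lborel)"
    using X tendsto_minus[OF X(2)] by (intro difference_quotient_tendsto[OF h g b]) auto
  ultimately have "(\<lambda>n. - ((?C (t + X n) - ?C t) / of_real (X n)))
      \<longlonglongrightarrow> correlation h (partial_deriv b f) (x + t *\<^sub>R b)"
    by (simp only: dg correlation_def[of h "partial_deriv b f"])
  from tendsto_minus[OF tendsto_Re[OF this]]
  show "((\<lambda>s. (Re (?C (t + s)) - Re (?C t)) / s) \<circ> X)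
      \<longlonglongrightarrow> - Re (correlation h (partial_deriv b f) (x + t *\<^sub>R b))"
    by (simp add: o_def)
qed

lemma correlation_continuous:
  fixes h :: "'a::euclidean_space \<Rightarrow> complex"
  assumes h: "local_L1 h" and f: "f \<in> C_c_infinity UNIV"
  shows "continuous_on UNIV (correlation h f)"
  unfolding continuous_on_sequentially
proof (intro allI impI ballI)
  fix X :: "nat \<Rightarrow> 'a" and a :: 'a
  assume "(\<forall>n. X n \<in> UNIV) \<and> X \<longlonglongrightarrow> a"
  then have X: "X \<longlonglongrightarrow> a"
    by simp
  obtain B R where B: "B \<ge> 0" "\<And>x. cmod (f x) \<le> B * indicator (cball 0 R) x"
    using C_c_infinity_bounded[OF f] by metis
  obtain T where T: "\<And>n. norm (X n) \<le> T"
    using convergent_imp_Bseq[of X] X by (auto simp: convergent_def Bseq_def)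
  have cont: "continuous_on UNIV f"
    by (rule smooth_continuous_on[OF C_c_infinity_smooth[OF f]])
  then have [measurable]: "f \<in> borel_measurable borel"
    by (rule borel_measurable_continuous_onI)
  have "(\<lambda>n. \<integral>y. f (y - X n) * h y \<partial>lborel) \<longlonglongrightarrow> (\<integral>y. f (y - a) * h y \<partial>lborel)"
  proof (rule local_L1_dominated[OF h])
    show "cmod (f (y - X n)) \<le> B * indicator (cball 0 (R + T)) y" for n y
    proof -
      have "norm y \<le> R + T" if "norm (y - X n) \<le> R"
        using norm_triangle_ineq[of "y - X n" "X n"] that T[of n] by simp
      then show ?thesis
        using B(2)[of "y - X n"] B(1)
        by (cases "norm (y - X n) \<le> R"; cases "norm y \<le> R + T") auto
    qed
    have "(\<lambda>n. f (y - X n)) \<longlonglongrightarrow> f (y - a)" for y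
      using continuous_on_tendsto_compose[OF cont tendsto_diff[OF tendsto_const X]] by simp
    then show "AE y in lborel. (\<lambda>n. f (y - X n)) \<longlonglongrightarrow> f (y - a)"
      by simp
  qed measurable
  then show "(correlation h f \<circ> X) \<longlonglongrightarrow> correlation h f a"
    by (simp add: correlation_def o_def)
qed

text \<open>The inequality 2 a b \<le> a^2 + b^2 is integrated; translation invariance makes the
  bound independent of \<open>x\<close>.\<close>

lemma correlation_bounded:
  fixes h :: "'a::euclidean_space \<Rightarrow> complex"
  assumes h: "square_integrable h" and f: "f \<in> C_c_infinity UNIV"
  shows "cmod (correlation h f x)
    \<le> ((\<integral>y. (cmod (f y))\<^sup>2 \<partial>lborel) + (\<integral>y. (cmod (h y))\<^sup>2 \<partial>lborel)) / 2"
proof -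
  note tr = C_c_infinity_translate[OF f, of x]
  have sq: "integrable lborel (\<lambda>y. (cmod (f (y - x)))\<^sup>2)" "integrable lborel (\<lambda>y. (cmod (h y))\<^sup>2)"
    using C_c_infinity_square_integrable[OF tr] h by (auto simp: square_integrable_def)
  have "cmod (correlation h f x) \<le> (\<integral>y. cmod (f (y - x) * h y) \<partial>lborel)"
    unfolding correlation_def by (rule integral_norm_bound)
  also have "\<dots> \<le> (\<integral>y. ((cmod (f (y - x)))\<^sup>2 + (cmod (h y))\<^sup>2) / 2 \<partial>lborel)"
  proof (rule integral_mono)
    show "integrable lborel (\<lambda>y. cmod (f (y - x) * h y))"
      using local_L1_integrable[OF local_L1_square_integrable[OF h] tr] by (rule integrable_norm)
    show "cmod (f (y - x) * h y) \<le> ((cmod (f (y - x)))\<^sup>2 + (cmod (h y))\<^sup>2) / 2" for y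
      using sum_squares_bound[of "cmod (f (y - x))" "cmod (h y)"] by (simp add: norm_mult)
  qed (use sq in auto)
  also have "\<dots> = ((\<integral>y. (cmod (f (y - x)))\<^sup>2 \<partial>lborel) + (\<integral>y. (cmod (h y))\<^sup>2 \<partial>lborel)) / 2"
    using sq by simp
  also have "(\<integral>y. (cmod (f (y - x)))\<^sup>2 \<partial>lborel) = (\<integral>y. (cmod (f y))\<^sup>2 \<partial>lborel)"
    using integral_translate[of "\<lambda>y. (cmod (f y))\<^sup>2" "- x"] C_c_infinity_measurable[OF f] by simp
  finally show ?thesis .
qed

text \<open>Every multiple \<open>c * h\<close> satisfies the same weak equation, so the maximum
  principle bounds the real part of \<open>c\<close> times the integral by 0 for all
  \<open>c\<close>. This leaves only the value 0.\<close>

theorem weak_solution_eq_0: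
  fixes h :: "'a::euclidean_space \<Rightarrow> complex"
  assumes h: "square_integrable h"
    and weak: "\<And>f. f \<in> C_c_infinity UNIV \<Longrightarrow> (\<integral>x. (f x + neg_laplacian f x) * h x \<partial>lborel) = 0"
    and f: "f \<in> C_c_infinity UNIV"
  shows "(\<integral>x. f x * h x \<partial>lborel) = 0"
proof -
  have nonpos: "Re (correlation (\<lambda>y. c * h y) f z) \<le> 0" for c z
  proof (rule bounded_subsolution_nonpos[where w="\<lambda>z. Re (correlation (\<lambda>y. c * h y) f z)"
        and dw="\<lambda>b z. - Re (correlation (\<lambda>y. c * h y) (partial_deriv b f) z)"
        and ddw="\<lambda>b z. Re (correlation (\<lambda>y. c * h y) (partial_deriv b (partial_deriv b f)) z)"
        and M="((\<integral>y. (cmod (f y))\<^sup>2 \<partial>lborel) + (\<integral>y. (cmod (c * h y))\<^sup>2 \<partial>lborel)) / 2"])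
    let ?h = "\<lambda>y. c * h y"
    have sq: "square_integrable ?h"
      using h by (rule square_integrable_cmult)
    then have h': "local_L1 ?h"
      by (rule local_L1_square_integrable)
    show "continuous_on UNIV (\<lambda>z. Re (correlation ?h f z))"
      by (intro continuous_intros correlation_continuous h' f)
    show "Re (correlation ?h f x) \<le> ((\<integral>y. (cmod (f y))\<^sup>2 \<partial>lborel) + (\<integral>y. (cmod (?h y))\<^sup>2 \<partial>lborel)) / 2" for x
      using correlation_bounded[OF sq f, of x] complex_Re_le_cmod order_trans by blast
    fix b x :: 'a and t :: real
    assume b: "b \<in> Basis"
    show "((\<lambda>t. Re (correlation ?h f (x + t *\<^sub>R b))) has_real_derivative
        - Re (correlation ?h (partial_deriv b f) (x + t *\<^sub>R b))) (at t)"
      by (rule correlation_has_derivative[OF h' f b])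
    show "((\<lambda>t. - Re (correlation ?h (partial_deriv b f) (x + t *\<^sub>R b))) has_real_derivative
        Re (correlation ?h (partial_deriv b (partial_deriv b f)) (x + t *\<^sub>R b))) (at t)"
      using DERIV_minus[OF correlation_has_derivative[OF h' C_c_infinity_partial_deriv[OF f b] b]]
      by simp
  next
    fix x
    let ?h = "\<lambda>y. c * h y"
    have h': "local_L1 ?h"
      using h by (intro local_L1_square_integrable square_integrable_cmult)
    have int: "integrable lborel (\<lambda>y. g (y - x) * ?h y)" if "g \<in> C_c_infinity UNIV" for g
      by (rule local_L1_integrable[OF h' C_c_infinity_translate[OF that]])
    have lap: "neg_laplacian (\<lambda>y. f (y - x)) = (\<lambda>y. neg_laplacian f (y - x))"
      using neg_laplacian_affine[OF C_c_infinity_smooth[OF f], of 1 "- x"] by simp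
    \<comment> \<open>The weak equation for the translate of \<open>f\<close> by \<open>x\<close>
      becomes the classical equation at the point \<open>x\<close>: the signs of the two
      differentiations cancel.\<close>
    have "(\<integral>y. c * ((f (y - x) + neg_laplacian f (y - x)) * h y) \<partial>lborel) = 0"
      using weak[OF C_c_infinity_translate[OF f, of x]] by (simp add: lap)
    then have "(\<integral>y. f (y - x) * ?h y + neg_laplacian f (y - x) * ?h y \<partial>lborel) = 0"
      by (simp add: algebra_simps)
    then have "correlation ?h f x = - correlation ?h (neg_laplacian f) x"
      using int[OF f] int[OF neg_laplacian_C_c_infinity[OF f]]
      by (simp add: correlation_def eq_neg_iff_add_eq_0)
    also have "\<dots> = (\<Sum>b\<in>Basis. correlation ?h (partial_deriv b (partial_deriv b f)) x)"
      using int[OF C_c_infinity_partial_deriv[OF C_c_infinity_partial_deriv[OF f]]]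
      by (simp add: correlation_def neg_laplacian_def sum_distrib_right Bochner_Integration.integral_sum)
    finally show "Re (correlation ?h f x)
        \<le> (\<Sum>b\<in>Basis. Re (correlation ?h (partial_deriv b (partial_deriv b f)) x))"
      by simp
  qed
  have "correlation (\<lambda>y. c * h y) f 0 = c * (\<integral>x. f x * h x \<partial>lborel)" for c
    by (simp add: correlation_def mult.left_commute)
  then have "Re (c * (\<integral>x. f x * h x \<partial>lborel)) \<le> 0" for c
    using nonpos[of c 0] by simp
  \<comment> \<open>With \<open>c\<close> the conjugate of the integral, the product is its squared
    modulus.\<close>
  from this[of "cnj (\<integral>x. f x * h x \<partial>lborel)"] show ?thesis
    by (simp add: mult.commute[of "cnj _"] flip: complex_norm_square of_real_power)
qed


section \<open>Test functions away from the origin separate functions\<close>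

text \<open>The positive and negative parts of \<open>r\<close> are densities of two measures that
  agree, with finite values, on all boxes. Boxes are stable under intersection and generate the
  Borel sets, so the measures coincide, and so do the densities almost everywhere.\<close>

lemma AE_eq_0_of_integral_box_eq_0:
  fixes r :: "'a::euclidean_space \<Rightarrow> real"
  assumes int: "\<And>a b. integrable lborel (\<lambda>x. indicator (box a b) x * r x)"
    and zero: "\<And>a b. (\<integral>x. indicator (box a b) x * r x \<partial>lborel) = 0"
    and [measurable]: "r \<in> borel_measurable borel"
  shows "AE x in lborel. r x = 0"
proof -
  define M where "M = density lborel (\<lambda>x. ennreal (r x))"
  define N where "N = density lborel (\<lambda>x. ennreal (- r x))"
  let ?E = "range (\<lambda>(a, b). box a b :: 'a set)"
  have meas: "emeasure M (box a b) = (\<integral>\<^sup>+x. ennreal (indicator (box a b) x * r x) \<partial>lborel)"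
    "emeasure N (box a b) = (\<integral>\<^sup>+x. ennreal (- (indicator (box a b) x * r x)) \<partial>lborel)" for a b
    unfolding M_def N_def
    by (subst emeasure_density; auto intro!: nn_integral_cong simp: indicator_def)+
  have fin: "emeasure M (box a b) \<noteq> \<infinity>" "emeasure N (box a b) \<noteq> \<infinity>" for a b
    using int[of a b] unfolding meas real_integrable_def by auto
  have eq: "emeasure M (box a b) = emeasure N (box a b)" for a b
  proof -
    have "enn2real (emeasure M (box a b)) = enn2real (emeasure N (box a b))"
      using zero[of a b] real_lebesgue_integral_def[OF int[of a b]] by (simp add: meas)
    then show ?thesis
      using fin[of a b] by (metis ennreal_enn2real top.not_eq_extremum infinity_ennreal_def)
  qed
  have "M = N"
  proof (rule measure_eqI_generator_eq)
    show "Int_stable ?E"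
      by (auto simp: Int_stable_def box_Int_box)
    show "emeasure M X = emeasure N X" if "X \<in> ?E" for X
      using that eq by auto
    show "sets M = sigma_sets UNIV ?E" "sets N = sigma_sets UNIV ?E"
      by (simp_all add: M_def N_def borel_eq_box)
    let ?A = "\<lambda>n::nat. box (- (real n *\<^sub>R One)) (real n *\<^sub>R One) :: 'a set"
    show "range ?A \<subseteq> ?E" "(\<Union>i. ?A i) = UNIV"
      unfolding UN_box_eq_UNIV by auto
    show "emeasure M (?A i) \<noteq> \<infinity>" for i
      by (rule fin)
  qed auto
  then have "AE x in lborel. ennreal (r x) = ennreal (- r x)"
    unfolding M_def N_def by (intro sigma_finite_measure.density_unique[OF sigma_finite_lborel]) auto
  then show ?thesis
  proof eventually_elim
    \<comment> \<open>\<open>ennreal\<close> sends negative reals to 0, so one of the two equal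
      sides vanishes, and hence both do.\<close>
    case (elim x)
    then show ?case
      by (cases "r x \<ge> 0") (auto simp: ennreal_neg ennreal_eq_0_iff dest: sym)
  qed
qed

lemma flat_0_tendsto_1:
  assumes "filterlim g at_top F"
  shows "((\<lambda>n. flat 0 (g n)) \<longlongrightarrow> 1) F"
proof -
  have "((\<lambda>n. exp (- 1 / g n)) \<longlongrightarrow> exp 0) F"
    by (intro tendsto_intros tendsto_divide_0[OF tendsto_const] filterlim_at_top_imp_at_infinity assms)
  moreover have "\<forall>\<^sub>F n in F. g n > 0"
    using assms by (simp add: filterlim_at_top_dense)
  then have "\<forall>\<^sub>F n in F. exp (- 1 / g n) = flat 0 (g n)"
    by eventually_elim (simp add: flat_0_pos)
  ultimately show ?thesis
    by (auto intro: Lim_transform_eventually)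
qed

lemma real_Suc_mult_at_top: "c > 0 \<Longrightarrow> filterlim (\<lambda>n. real (Suc n) * c) at_top sequentially"
  by (intro filterlim_at_top_mult_tendsto_pos[OF tendsto_const]
      filterlim_compose[OF filterlim_real_sequentially filterlim_Suc])

text \<open>For each real s, \<open>flat 0 (real (Suc n) * s)\<close> tends to 1 if s > 0 and is 0
  otherwise. One such factor per face produces the box; the radial factor vanishes for (n + 1) |x|^2
  \<le> 1, which keeps the support away from the origin while losing only that point in the
  limit.\<close>

lemma box_approximation:
  fixes a b :: "'a::euclidean_space"
  obtains q :: "nat \<Rightarrow> 'a \<Rightarrow> real" and R
  where "\<And>n. (\<lambda>x. complex_of_real (q n x)) \<in> C_c_infinity (UNIV - {0})"
    "\<And>n x. cmod (complex_of_real (q n x)) \<le> 1 * indicator (cball 0 R) x"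
    "\<And>x. x \<noteq> 0 \<Longrightarrow> (\<lambda>n. q n x) \<longlonglongrightarrow> indicator (box a b) x"
proof -
  define q where "q n x = flat 0 (real (Suc n) * (real (Suc n) * (norm x)\<^sup>2 - 1)) *
    (\<Prod>i\<in>Basis. flat 0 (real (Suc n) * (x \<bullet> i - a \<bullet> i)) * flat 0 (real (Suc n) * (b \<bullet> i - x \<bullet> i)))" for n x
  have out: "q n x = 0" if "x \<notin> box a b" for n x
  proof -
    obtain i where i: "i \<in> Basis" "x \<bullet> i - a \<bullet> i \<le> 0 \<or> b \<bullet> i - x \<bullet> i \<le> 0"
      using \<open>x \<notin> box a b\<close> by (force simp: mem_box not_less)
    then have "flat 0 (real (Suc n) * (x \<bullet> i - a \<bullet> i)) = 0 \<or> flat 0 (real (Suc n) * (b \<bullet> i - x \<bullet> i)) = 0"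
      by (intro disj_forward[OF i(2)] flat_nonpos mult_nonneg_nonpos) auto
    then have "(\<Prod>i\<in>Basis. flat 0 (real (Suc n) * (x \<bullet> i - a \<bullet> i)) * flat 0 (real (Suc n) * (b \<bullet> i - x \<bullet> i))) = 0"
      using i(1) by (intro prod_zero) auto
    then show ?thesis
      by (simp add: q_def)
  qed
  have q01: "0 \<le> q n x" "q n x \<le> 1" for n x
    unfolding q_def
    by (intro mult_nonneg_nonneg prod_nonneg ballI flat_0_bounds mult_le_one prod_le_1 conjI)+
  obtain R where R: "cbox a b \<subseteq> cball 0 R"
    using bounded_cbox[of a b] by (auto simp: bounded_iff subset_iff)
  show ?thesis
  proof (rule that)
    fix n
    let ?K = "cbox a b \<inter> {x. 1 \<le> real (Suc n) * (norm x)\<^sup>2}"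
    show "(\<lambda>x. complex_of_real (q n x)) \<in> C_c_infinity (UNIV - {0})"
    proof (rule C_c_infinityI)
      show "smooth (\<lambda>x. complex_of_real (q n x))"
        unfolding q_def of_real_mult of_real_prod of_real_diff
        by (intro smooth_mult smooth_prod smooth_flat; simp only: of_real_mult of_real_diff;
            intro smooth_mult smooth_diff smooth_const smooth_inner smooth_norm_square)
      show "compact ?K"
        by (intro compact_Int_closed compact_cbox closed_Collect_le continuous_intros)
      show "complex_of_real (q n x) = 0" if "x \<notin> ?K" for x
      proof (cases "x \<in> cbox a b")
        case True
        then have "real (Suc n) * (norm x)\<^sup>2 - 1 \<le> 0"
          using that by simp
        then have "flat 0 (real (Suc n) * (real (Suc n) * (norm x)\<^sup>2 - 1)) = 0"
          by (intro flat_nonpos mult_nonneg_nonpos) auto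
        then show ?thesis
          by (simp add: q_def)
      qed (use out box_subset_cbox in force)
    qed auto
  next
    fix n x
    show "cmod (complex_of_real (q n x)) \<le> 1 * indicator (cball 0 R) x"
      using q01[of n x] out[of x n] R box_subset_cbox[of a b] by (cases "x \<in> box a b") auto
  next
    fix x :: 'a
    assume "x \<noteq> 0"
    show "(\<lambda>n. q n x) \<longlonglongrightarrow> indicator (box a b) x"
    proof (cases "x \<in> box a b")
      case True
      have "filterlim (\<lambda>n. real (Suc n) * (real (Suc n) * (norm x)\<^sup>2 - 1)) at_top sequentially"
        using \<open>x \<noteq> 0\<close>
        by (intro filterlim_at_top_mult_at_top filterlim_tendsto_add_at_top[OF tendsto_const, of _ _ "-1", simplified]
            filterlim_compose[OF filterlim_real_sequentially filterlim_Suc] real_Suc_mult_at_top) simp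
      then have "(\<lambda>n. q n x) \<longlonglongrightarrow> 1 * (\<Prod>i\<in>(Basis :: 'a set). 1 * 1)"
        unfolding q_def using True
        by (intro tendsto_mult tendsto_prod flat_0_tendsto_1 real_Suc_mult_at_top) (auto simp: mem_box)
      then show ?thesis
        using True by simp
    next
      case False
      then show ?thesis
        using out by simp
    qed
  qed
qed

lemma AE_lborel_neq: "AE x in lborel. x \<noteq> (c :: 'a::euclidean_space)"
  by (rule AE_I[of _ _ "{c}"]) auto

text \<open>Approximating boxes shows that \<open>h\<close> has integral zero over each of them.
  Avoiding the origin is harmless because a point is a null set.\<close>

theorem test_functions_separating:
  fixes h :: "'a::euclidean_space \<Rightarrow> complex"
  assumes h: "local_L1 h"
    and zero: "\<And>f. f \<in> C_c_infinity (UNIV - {0}) \<Longrightarrow> (\<integral>x. f x * h x \<partial>lborel) = 0"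
  shows "AE x in lborel. h x = 0"
proof -
  have [measurable]: "h \<in> borel_measurable borel"
    using h by (simp add: local_L1_def)
  have int: "integrable lborel (\<lambda>x. indicator (box a b) x * h x)" for a b
  proof -
    obtain R where R: "box a b \<subseteq> cball 0 R"
      using bounded_box[of a b] by (auto simp: bounded_iff subset_iff)
    show ?thesis
    proof (rule Bochner_Integration.integrable_bound)
      show "integrable lborel (\<lambda>x. indicator (cball 0 R) x * cmod (h x))"
        using h by (simp add: local_L1_def)
      show "AE x in lborel. norm (indicator (box a b) x * h x)
          \<le> norm (indicator (cball 0 R) x * cmod (h x))"
        using R by (intro AE_I2) (auto simp: indicator_def norm_mult)
    qed measurable
  qed
  have int0: "(\<integral>x. indicator (box a b) x * h x \<partial>lborel) = 0" for a b
  proof -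
    obtain q :: "nat \<Rightarrow> 'a \<Rightarrow> real" and R where q: "\<And>n. (\<lambda>x. complex_of_real (q n x)) \<in> C_c_infinity (UNIV - {0})"
      and bound: "\<And>n x. cmod (complex_of_real (q n x)) \<le> 1 * indicator (cball 0 R) x"
      and lim: "\<And>x. x \<noteq> 0 \<Longrightarrow> (\<lambda>n. q n x) \<longlonglongrightarrow> indicator (box a b) x"
      using box_approximation[of a b] by metis
    have "(\<lambda>n. \<integral>x. complex_of_real (q n x) * h x \<partial>lborel)
        \<longlonglongrightarrow> (\<integral>x. complex_of_real (indicator (box a b) x) * h x \<partial>lborel)"
    proof (rule local_L1_dominated[OF h])
      show "AE x in lborel. (\<lambda>n. complex_of_real (q n x)) \<longlonglongrightarrow> complex_of_real (indicator (box a b) x)"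
        using AE_lborel_neq[of 0] by eventually_elim (intro tendsto_of_real lim)
      show "(\<lambda>x. complex_of_real (q n x)) \<in> borel_measurable borel" for n
        by (rule C_c_infinity_measurable[OF q])
      show "cmod (complex_of_real (q n x)) \<le> 1 * indicator (cball 0 R) x" for n x
        by (rule bound)
    qed measurable
    then have "(\<integral>x. complex_of_real (indicator (box a b) x) * h x \<partial>lborel) = 0"
      by (simp add: zero[OF q] LIMSEQ_const_iff)
    then show ?thesis
      by (simp add: indicator_def of_bool_def if_distrib cong: if_cong)
  qed
  have re: "Re (indicator (box a b) x * h x) = indicator (box a b) x * Re (h x)"
    and im: "Im (indicator (box a b) x * h x) = indicator (box a b) x * Im (h x)" for a b x
    by (auto simp: indicator_def)
  have "AE x in lborel. Re (h x) = 0"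
  proof (rule AE_eq_0_of_integral_box_eq_0)
    show "integrable lborel (\<lambda>x. indicator (box a b) x * Re (h x))" for a b
      using integrable_Re[OF int[of a b]] by (simp only: re)
    show "(\<integral>x. indicator (box a b) x * Re (h x) \<partial>lborel) = 0" for a b
      using integral_Re[OF int[of a b]] by (simp only: re int0 zero_complex.sel)
  qed measurable
  moreover have "AE x in lborel. Im (h x) = 0"
  proof (rule AE_eq_0_of_integral_box_eq_0)
    show "integrable lborel (\<lambda>x. indicator (box a b) x * Im (h x))" for a b
      using integrable_Im[OF int[of a b]] by (simp only: im)
    show "(\<integral>x. indicator (box a b) x * Im (h x) \<partial>lborel) = 0" for a b
      using integral_Im[OF int[of a b]] by (simp only: im int0 zero_complex.sel)
  qed measurable
  ultimately show ?thesis
    by eventually_elim (simp add: complex_eq_iff)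
qed

section \<open>Removing the singularity at the origin\<close>

lemma cutoff_function:
  obtains \<psi> :: "'a::euclidean_space \<Rightarrow> complex"
  where "\<psi> \<in> C_c_infinity UNIV" "\<And>x. norm x \<le> 1 / 2 \<Longrightarrow> \<psi> x = 1"
proof -
  \<comment> \<open>The outer \<open>flat 0\<close> sees a constant where the inner one vanishes, and a nonpositive argument
    where the inner one exceeds \<open>exp (- 1)\<close>.\<close>
  define \<psi> :: "'a \<Rightarrow> complex" where
    "\<psi> x = of_real (exp (exp 1)) * of_real (flat 0 (exp (- 1) - flat 0 (2 * (norm x)\<^sup>2 - 1)))" for x
  have "smooth \<psi>"
    unfolding \<psi>_def
    by (intro smooth_mult smooth_const smooth_flat; simp only: of_real_mult of_real_diff;
        intro smooth_mult smooth_diff smooth_const smooth_flat; simp only: of_real_mult of_real_diff;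
        intro smooth_mult smooth_diff smooth_const smooth_norm_square)
  moreover have "\<psi> x = 0" if "x \<notin> cball 0 1" for x
  proof -
    have "1\<^sup>2 \<le> (norm x)\<^sup>2"
      using that by (intro power_mono) auto
    then have "2 * (norm x)\<^sup>2 - 1 \<ge> 1"
      by simp
    then have "exp (- 1) \<le> flat 0 (2 * (norm x)\<^sup>2 - 1)"
      by (subst flat_0_pos) (auto simp: field_simps)
    then show ?thesis
      by (simp add: \<psi>_def flat_nonpos)
  qed
  ultimately have "\<psi> \<in> C_c_infinity UNIV"
    by (intro C_c_infinityI[of _ "cball 0 1"]) auto
  moreover have "\<psi> x = 1" if "norm x \<le> 1 / 2" for x
  proof -
    have "(norm x)\<^sup>2 \<le> (1 / 2)\<^sup>2"
      using that by (intro power_mono) auto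
    then have "flat 0 (2 * (norm x)\<^sup>2 - 1) = 0"
      by (intro flat_nonpos) (simp add: power2_eq_square)
    \<comment> \<open>Here the outer function takes the value \<open>flat 0 (exp (- 1))\<close>,
      which is \<open>exp (- exp 1)\<close>; the prefactor of \<psi> is its inverse.\<close>
    then show ?thesis
      by (simp add: \<psi>_def flat_0_pos exp_minus divide_inverse flip: of_real_mult exp_add)
  qed
  ultimately show ?thesis
    by (rule that)
qed

text \<open>Serves to bound a test function, its first partial derivatives and its Laplacian by the
  same constants.\<close>

lemma finite_C_c_infinity_bounded:
  fixes F :: "('a::euclidean_space \<Rightarrow> complex) set"
  assumes "finite F" "F \<subseteq> C_c_infinity UNIV"
  obtains B R where "B \<ge> 0" "R \<ge> 0" "\<And>f x. f \<in> F \<Longrightarrow> cmod (f x) \<le> B * indicator (cball 0 R) x"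
proof -
  have "\<exists>B R. B \<ge> 0 \<and> R \<ge> 0 \<and> (\<forall>f\<in>F. \<forall>x. cmod (f x) \<le> B * indicator (cball 0 R) x)"
    using assms
  proof (induction F)
    case empty
    then show ?case
      by (intro exI[of _ 0]) auto
  next
    case (insert f F)
    then obtain B R where 1: "B \<ge> 0" "R \<ge> 0" "\<forall>f\<in>F. \<forall>x. cmod (f x) \<le> B * indicator (cball 0 R) x"
      by auto
    obtain B' R' where 2: "B' \<ge> 0" "R' \<ge> 0" "\<And>x. cmod (f x) \<le> B' * indicator (cball 0 R') x"
      using C_c_infinity_bounded[of f UNIV] insert.prems by auto
    have le: "b * indicator (cball 0 r) x \<le> max B B' * indicator (cball 0 (max R R')) x"
      if "b \<le> max B B'" "r \<le> max R R'" for b r and x :: 'a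
      using that 1(1) by (auto simp: indicator_def)
    have "cmod (g x) \<le> max B B' * indicator (cball 0 (max R R')) x" if "g \<in> insert f F" for g x
      using that order_trans[OF 2(3) le[of B' R' x]] order_trans[OF 1(3)[rule_format] le[of B R x]]
      by auto
    moreover have "0 \<le> max B B'" "0 \<le> max R R'"
      using 1 by auto
    ultimately show ?case
      by blast
  qed
  then show ?thesis
    using that by blast
qed

text \<open>In the Leibniz rule, each derivative that falls on the scaled cutoff costs a factor
  \<open>N\<close>. The localization to the ball of radius \<open>R / N\<close> comes from \<psi>
  and its derivatives, while \<open>f\<close> and its derivatives contribute only the bound
  \<open>A\<close>.\<close>

lemma scaled_cutoff_bound:
  fixes f \<psi> :: "'a::euclidean_space \<Rightarrow> complex"
  assumes f: "f \<in> C_c_infinity UNIV" and \<psi>: "\<psi> \<in> C_c_infinity UNIV"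
  obtains C R where "C \<ge> 0" "R \<ge> 0"
    "\<And>N x. N \<ge> 1 \<Longrightarrow> cmod (\<psi> (N *\<^sub>R x) * f x + neg_laplacian (\<lambda>x. \<psi> (N *\<^sub>R x) * f x) x)
      \<le> C * N\<^sup>2 * indicator (cball 0 (R / N)) x"
proof -
  let ?F = "\<lambda>f. insert f (insert (neg_laplacian f) ((\<lambda>b. partial_deriv b f) ` Basis))"
  have F: "finite (?F g)" "?F g \<subseteq> C_c_infinity UNIV" if "g \<in> C_c_infinity UNIV" for g :: "'a \<Rightarrow> complex"
    using that by (auto intro: neg_laplacian_C_c_infinity C_c_infinity_partial_deriv)
  obtain B R where B: "B \<ge> 0" "R \<ge> 0" "\<And>g x. g \<in> ?F \<psi> \<Longrightarrow> cmod (g x) \<le> B * indicator (cball 0 R) x"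
    using finite_C_c_infinity_bounded[OF F[OF \<psi>]] by metis
  obtain A S where A: "A \<ge> 0" "\<And>g x. g \<in> ?F f \<Longrightarrow> cmod (g x) \<le> A * indicator (cball 0 S) x"
    using finite_C_c_infinity_bounded[OF F[OF f]] by metis
  have A': "cmod (g x) \<le> A" if "g \<in> ?F f" for g x
    using A(2)[OF that, of x] A(1) by (cases "x \<in> cball 0 S") auto
  show ?thesis
  proof (rule that)
    show "(3 + 2 * real DIM('a)) * (B * A) \<ge> 0" "R \<ge> 0"
      using A B by auto
    fix N :: real and x :: 'a
    assume N: "N \<ge> 1"
    let ?I = "indicator (cball 0 (R / N)) x :: real"
    have I: "indicator (cball 0 R) (N *\<^sub>R x) = ?I"
      using N by (simp add: indicator_def field_simps)
    have bd: "cmod (g (N *\<^sub>R x) * k x) \<le> B * A * ?I" if "g \<in> ?F \<psi>" "k \<in> ?F f" for g k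
      using mult_mono[OF B(3)[OF that(1), of "N *\<^sub>R x"] A'[OF that(2), of x]] A(1) B(1)
      by (simp add: norm_mult I mult_ac)
    have BA: "B * A * ?I \<le> N\<^sup>2 * (B * A * ?I)" "N * (B * A * ?I) \<le> N\<^sup>2 * (B * A * ?I)"
      using N A(1) B(1) one_le_power[of N 2] mult_right_mono[of 1 "N\<^sup>2" "B * A * ?I"]
        mult_right_mono[of N "N\<^sup>2" "B * A * ?I"] self_le_power[of N 2] by auto
    have sm: "smooth f" "smooth \<psi>" "smooth (\<lambda>x. \<psi> (N *\<^sub>R x))"
      using f \<psi> smooth_affine[of \<psi> N 0] by (auto intro: C_c_infinity_smooth)
    have d1: "partial_deriv b (\<lambda>x. \<psi> (N *\<^sub>R x)) x = of_real N * partial_deriv b \<psi> (N *\<^sub>R x)" for b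
      using partial_deriv_affine[of \<psi> b N 0] sm by (simp add: smooth_differentiable)
    have d2: "neg_laplacian (\<lambda>x. \<psi> (N *\<^sub>R x)) x = of_real (N\<^sup>2) * neg_laplacian \<psi> (N *\<^sub>R x)"
      using neg_laplacian_affine[of \<psi> N 0] sm by simp
    have "\<psi> (N *\<^sub>R x) * f x + neg_laplacian (\<lambda>x. \<psi> (N *\<^sub>R x) * f x) x
      = \<psi> (N *\<^sub>R x) * f x + \<psi> (N *\<^sub>R x) * neg_laplacian f x
        + of_real (N\<^sup>2) * (neg_laplacian \<psi> (N *\<^sub>R x) * f x)
        - 2 * (\<Sum>b\<in>Basis. of_real N * (partial_deriv b \<psi> (N *\<^sub>R x) * partial_deriv b f x))"
      using sm by (simp add: neg_laplacian_mult d1 d2 algebra_simps)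
    also have "cmod \<dots> \<le> B * A * ?I + B * A * ?I + N\<^sup>2 * (B * A * ?I)
        + 2 * (\<Sum>b\<in>(Basis :: 'a set). N * (B * A * ?I))"
    proof (intro order_trans[OF norm_triangle_ineq4] order_trans[OF norm_triangle_ineq] add_mono)
      show "cmod (\<psi> (N *\<^sub>R x) * f x) \<le> B * A * ?I" "cmod (\<psi> (N *\<^sub>R x) * neg_laplacian f x) \<le> B * A * ?I"
        by (intro bd; simp)+
      show "cmod (of_real (N\<^sup>2) * (neg_laplacian \<psi> (N *\<^sub>R x) * f x)) \<le> N\<^sup>2 * (B * A * ?I)"
        unfolding norm_mult[of "of_real _"] norm_of_real abs_power2
        by (intro mult_left_mono bd) auto
      have "cmod (\<Sum>b\<in>Basis. of_real N * (partial_deriv b \<psi> (N *\<^sub>R x) * partial_deriv b f x))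
          \<le> (\<Sum>b\<in>(Basis :: 'a set). N * (B * A * ?I))"
      proof (rule sum_norm_le)
        fix b :: 'a
        assume "b \<in> Basis"
        then show "cmod (of_real N * (partial_deriv b \<psi> (N *\<^sub>R x) * partial_deriv b f x)) \<le> N * (B * A * ?I)"
          unfolding norm_mult[of "of_real _"] norm_of_real abs_of_nonneg[OF order_trans[OF zero_le_one N]]
          using N by (intro mult_left_mono bd) auto
      qed
      then show "cmod (2 * (\<Sum>b\<in>Basis. of_real N * (partial_deriv b \<psi> (N *\<^sub>R x) * partial_deriv b f x)))
          \<le> 2 * (\<Sum>b\<in>(Basis :: 'a set). N * (B * A * ?I))"
        by (simp add: norm_mult)
    qed
    \<comment> \<open>Since N \<ge> 1, the factors 1 and N are absorbed into N^2. Three separate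
      terms and d mixed terms with coefficient 2 make up the constant 3 + 2 d.\<close>
    also have "\<dots> \<le> N\<^sup>2 * (B * A * ?I) + N\<^sup>2 * (B * A * ?I) + N\<^sup>2 * (B * A * ?I)
        + 2 * (\<Sum>b\<in>(Basis :: 'a set). N\<^sup>2 * (B * A * ?I))"
      by (intro add_mono mult_left_mono sum_mono BA) (use A(1) B(1) in auto)
    also have "\<dots> = (3 + 2 * real DIM('a)) * (B * A) * N\<^sup>2 * ?I"
      by (simp add: algebra_simps)
    finally show "cmod (\<psi> (N *\<^sub>R x) * f x + neg_laplacian (\<lambda>x. \<psi> (N *\<^sub>R x) * f x) x)
        \<le> (3 + 2 * real DIM('a)) * (B * A) * N\<^sup>2 * ?I" .
  qed
qed

text \<open>By the Cauchy-Schwarz inequality the error made by cutting off at radius \<open>1 / N\<close> is at most a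
  constant times \<open>N\<^sup>2\<close> times the square root of the volume \<open>N powr - d\<close> times the norm of \<open>h\<close> on
  the shrinking ball. This tends to zero as soon as \<open>d \<ge> 4\<close>.\<close>

theorem weak_equation_extends_over_origin:
  fixes h :: "'a::euclidean_space \<Rightarrow> complex"
  assumes dim: "DIM('a) \<ge> 4" and h: "square_integrable h"
    and weak: "\<And>f. f \<in> C_c_infinity (UNIV - {0}) \<Longrightarrow>
      (\<integral>x. (f x + neg_laplacian f x) * h x \<partial>lborel) = 0"
    and f: "f \<in> C_c_infinity UNIV"
  shows "(\<integral>x. (f x + neg_laplacian f x) * h x \<partial>lborel) = 0"
proof -
  define I where "I = (\<integral>x. (f x + neg_laplacian f x) * h x \<partial>lborel)"
  have L1: "local_L1 h" and sq: "integrable lborel (\<lambda>x. (cmod (h x))\<^sup>2)"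
    and [measurable]: "h \<in> borel_measurable borel"
    using h by (auto simp: local_L1_square_integrable square_integrable_def)
  have int: "integrable lborel (\<lambda>x. (g x + neg_laplacian g x) * h x)" if "g \<in> C_c_infinity UNIV" for g
    using that by (intro local_L1_integrable[OF L1] C_c_infinity_add neg_laplacian_C_c_infinity)
  obtain \<psi> :: "'a \<Rightarrow> complex" where \<psi>: "\<psi> \<in> C_c_infinity UNIV" and \<psi>1: "\<And>x. norm x \<le> 1 / 2 \<Longrightarrow> \<psi> x = 1"
    using cutoff_function by metis
  obtain C R where C: "C \<ge> 0" "R \<ge> 0"
    "\<And>N x. N \<ge> 1 \<Longrightarrow> cmod (\<psi> (N *\<^sub>R x) * f x + neg_laplacian (\<lambda>x. \<psi> (N *\<^sub>R x) * f x) x)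
      \<le> C * N\<^sup>2 * indicator (cball 0 (R / N)) x"
    using scaled_cutoff_bound[OF f \<psi>] by metis
  define V where "V = unit_ball_vol (real DIM('a)) * R ^ DIM('a)"
  define a where "a n = (\<integral>x. indicator (cball 0 (R / real (Suc n))) x * (cmod (h x))\<^sup>2 \<partial>lborel)" for n
  have [measurable]: "cball (0 :: 'a) r \<in> sets borel" for r
    by simp
  \<comment> \<open>The balls shrink to the origin, a null set. In dimension 4 this decay is the
    only source of smallness.\<close>
  have "a \<longlonglongrightarrow> integral\<^sup>L lborel (\<lambda>x::'a. 0 :: real)"
    unfolding a_def
  proof (rule integral_dominated_convergence[where w="\<lambda>x. (cmod (h x))\<^sup>2"])
    show "AE x in lborel. (\<lambda>n. indicator (cball 0 (R / real (Suc n))) x * (cmod (h x))\<^sup>2) \<longlonglongrightarrow> 0"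
      using AE_lborel_neq[of 0]
    proof eventually_elim
      fix x :: 'a
      assume "x \<noteq> 0"
      have "(\<lambda>n. R * inverse (real (Suc n))) \<longlonglongrightarrow> R * 0"
        by (intro tendsto_intros LIMSEQ_inverse_real_of_nat)
      then have "\<forall>\<^sub>F n in sequentially. R * inverse (real (Suc n)) < norm x"
        using \<open>x \<noteq> 0\<close> by (intro order_tendstoD(2)) auto
      then have "\<forall>\<^sub>F n in sequentially. 0 = indicator (cball 0 (R / real (Suc n))) x * (cmod (h x))\<^sup>2"
        by eventually_elim (simp add: divide_inverse indicator_def)
      then show "(\<lambda>n. indicator (cball 0 (R / real (Suc n))) x * (cmod (h x))\<^sup>2) \<longlonglongrightarrow> 0"
        by (rule Lim_transform_eventually[OF tendsto_const])
    qed
  qed (use sq in \<open>auto simp: indicator_def\<close>)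
  then have a0: "a \<longlonglongrightarrow> 0"
    by simp
  \<comment> \<open>The inequality 2 a b \<le> \<eta> a^2 + b^2 / \<eta> under the integral plays
    the part of Cauchy-Schwarz. The weight \<eta> stays fixed while \<open>n\<close> tends to
    infinity, which removes \<open>a n / \<eta>\<close>; afterwards \<eta> tends to 0, which removes
    \<open>\<eta> * V\<close>.\<close>
  have bound: "cmod I \<le> C / 2 * (\<eta> * V + a n / \<eta>)" if "\<eta> > 0" for \<eta> n
  proof -
    let ?N = "real (Suc n)"
    let ?B = "cball 0 (R / ?N) :: 'a set"
    let ?g = "\<lambda>x. \<psi> (?N *\<^sub>R x) * f x"
    have sm: "smooth (\<lambda>x. \<psi> (?N *\<^sub>R x))"
      using smooth_affine[OF C_c_infinity_smooth[OF \<psi>], of ?N 0] by simp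
    then have g: "?g \<in> C_c_infinity UNIV"
      by (rule C_c_infinity_mult[OF f])
    have neg_g: "(\<lambda>x. (-1) * ?g x) \<in> C_c_infinity UNIV"
      by (rule C_c_infinity_mult[OF g]) simp
    obtain K where K: "compact K" "\<And>x. x \<notin> K \<Longrightarrow> f x = 0"
      using f by (elim C_c_infinityE) metis
    \<comment> \<open>The scaled cutoff equals 1 near the origin, so \<open>f - ?g\<close> vanishes
      there and is an admissible test function. Only the contribution of \<open>?g\<close> to
      \<open>I\<close> survives.\<close>
    have "(\<lambda>x. f x + (-1) * ?g x) \<in> C_c_infinity (UNIV - {0})"
    proof (rule C_c_infinityI)
      show "smooth (\<lambda>x. f x + (-1) * ?g x)"
        by (rule C_c_infinity_smooth[OF C_c_infinity_add[OF f neg_g]])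
      show "compact (K \<inter> {x. 1 / 2 \<le> ?N * norm x})"
        using K(1) by (intro compact_Int_closed closed_Collect_le continuous_intros)
      show "f x + (-1) * ?g x = 0" if "x \<notin> K \<inter> {x. 1 / 2 \<le> ?N * norm x}" for x
        using that K(2)[of x] \<psi>1[of "?N *\<^sub>R x"] by (cases "x \<in> K") auto
    qed auto
    from weak[OF this] have "(\<integral>x. (f x + neg_laplacian f x) * h x - (?g x + neg_laplacian ?g x) * h x \<partial>lborel) = 0"
      using C_c_infinity_smooth[OF f] C_c_infinity_smooth[OF g] C_c_infinity_smooth[OF neg_g]
      by (simp only: neg_laplacian_add neg_laplacian_cmult) (simp add: algebra_simps)
    then have "I = (\<integral>x. (?g x + neg_laplacian ?g x) * h x \<partial>lborel)"
      using int[OF f] int[OF g] by (simp add: I_def)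
    also have "cmod \<dots> \<le> (\<integral>x. cmod ((?g x + neg_laplacian ?g x) * h x) \<partial>lborel)"
      by (rule integral_norm_bound)
    also have "\<dots> \<le> (\<integral>x. C / 2 * (\<eta> * (?N ^ 4 * indicator ?B x) + indicator ?B x * (cmod (h x))\<^sup>2 / \<eta>) \<partial>lborel)"
    proof (rule integral_mono)
      show "integrable lborel (\<lambda>x. cmod ((?g x + neg_laplacian ?g x) * h x))"
        by (rule integrable_norm[OF int[OF g]])
      have "integrable lborel (\<lambda>x. indicator ?B x * (cmod (h x))\<^sup>2)"
        using integrable_mult_indicator[OF _ sq, of ?B] by simp
      then show "integrable lborel
          (\<lambda>x. C / 2 * (\<eta> * (?N ^ 4 * indicator ?B x) + indicator ?B x * (cmod (h x))\<^sup>2 / \<eta>))"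
        by (intro Bochner_Integration.integrable_mult_right Bochner_Integration.integrable_add
            integrable_divide integrable_indicator_cball)
      fix x :: 'a
      have "cmod ((?g x + neg_laplacian ?g x) * h x) \<le> C * ?N\<^sup>2 * indicator ?B x * cmod (h x)"
        unfolding norm_mult by (intro mult_right_mono C) auto
      also have "\<dots> = C / 2 * indicator ?B x * (2 * (?N\<^sup>2 * cmod (h x)))"
        by simp
      also have "\<dots> \<le> C / 2 * indicator ?B x * (\<eta> * ?N ^ 4 + (cmod (h x))\<^sup>2 / \<eta>)"
      proof (intro mult_left_mono)
        have "2 * (?N\<^sup>2 * cmod (h x)) = 2 * (sqrt \<eta> * ?N\<^sup>2) * (cmod (h x) / sqrt \<eta>)"
          using \<open>\<eta> > 0\<close> by simp
        also have "\<dots> \<le> (sqrt \<eta> * ?N\<^sup>2)\<^sup>2 + (cmod (h x) / sqrt \<eta>)\<^sup>2"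
          by (rule sum_squares_bound)
        also have "\<dots> = \<eta> * ?N ^ 4 + (cmod (h x))\<^sup>2 / \<eta>"
          using \<open>\<eta> > 0\<close> by (simp add: power_mult_distrib power_divide flip: power_mult)
        finally show "2 * (?N\<^sup>2 * cmod (h x)) \<le> \<eta> * ?N ^ 4 + (cmod (h x))\<^sup>2 / \<eta>" .
      qed (use C in auto)
      also have "\<dots> = C / 2 * (\<eta> * (?N ^ 4 * indicator ?B x) + indicator ?B x * (cmod (h x))\<^sup>2 / \<eta>)"
        by (simp add: indicator_def)
      finally show "cmod ((?g x + neg_laplacian ?g x) * h x)
          \<le> C / 2 * (\<eta> * (?N ^ 4 * indicator ?B x) + indicator ?B x * (cmod (h x))\<^sup>2 / \<eta>)" .
    qed
    also have "\<dots> = C / 2 * (\<eta> * (?N ^ 4 * measure lborel ?B) + a n / \<eta>)"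
    proof -
      have "integrable lborel (\<lambda>x. indicator ?B x * (cmod (h x))\<^sup>2)"
        using integrable_mult_indicator[OF _ sq, of ?B] by simp
      moreover have "integrable lborel (\<lambda>x::'a. \<eta> * (?N ^ 4 * indicator ?B x))"
        by (intro Bochner_Integration.integrable_mult_right integrable_indicator_cball)
      ultimately show ?thesis
        by (simp add: a_def)
    qed
    also have "\<dots> \<le> C / 2 * (\<eta> * V + a n / \<eta>)"
    proof (intro mult_left_mono add_mono order_refl)
      \<comment> \<open>The ball has volume V / N^d, so the product is V N^(4 - d), which is at most
        \<open>V\<close> exactly because d \<ge> 4.\<close>
      have "?N ^ 4 * measure lborel ?B = V * (?N ^ 4 / ?N ^ DIM('a))"
        using C(2) by (simp add: content_cball V_def power_divide)
      also have "\<dots> \<le> V * 1"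
        using C(2) dim power_increasing[OF dim, of ?N] by (intro mult_left_mono) (auto simp: V_def)
      finally show "?N ^ 4 * measure lborel ?B \<le> V"
        by simp
    qed (use C \<open>\<eta> > 0\<close> in auto)
    finally show ?thesis .
  qed
  have lim: "cmod I \<le> C / 2 * (\<eta> * V)" if "\<eta> > 0" for \<eta>
  proof (rule LIMSEQ_le_const)
    have "(\<lambda>n. C / 2 * (\<eta> * V + a n / \<eta>)) \<longlonglongrightarrow> C / 2 * (\<eta> * V + 0 / \<eta>)"
      using that by (intro tendsto_intros a0) auto
    then show "(\<lambda>n. C / 2 * (\<eta> * V + a n / \<eta>)) \<longlonglongrightarrow> C / 2 * (\<eta> * V)"
      by simp
  qed (use bound that in blast)
  have "(\<lambda>n. C / 2 * (inverse (real (Suc n)) * V)) \<longlonglongrightarrow> C / 2 * (0 * V)"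
    by (intro tendsto_intros LIMSEQ_inverse_real_of_nat)
  then have "cmod I \<le> C / 2 * (0 * V)"
    by (rule LIMSEQ_le_const) (use lim in auto)
  then show ?thesis
    by (simp add: I_def)
qed

section \<open>Essential self-adjointness\<close>

lemma L_op_cases:
  assumes "(u, v) \<in> L_op"
  obtains f where "f \<in> C_c_infinity (UNIV - {0})" "u = abs_L2 f" "v = abs_L2 (neg_laplacian f)"
  using assms by (auto simp: L_op_def)

lemma L_op_intro: "f \<in> C_c_infinity (UNIV - {0}) \<Longrightarrow> (abs_L2 f, abs_L2 (neg_laplacian f)) \<in> L_op"
  by (auto simp: L_op_def)

lemma abs_L2_add:
  "square_integrable f \<Longrightarrow> square_integrable g \<Longrightarrow> abs_L2 f + abs_L2 g = abs_L2 (\<lambda>x. f x + g x)"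
  by (simp add: plus_L2.abs_eq L2_eq_refl)

lemma abs_L2_cscale: "square_integrable f \<Longrightarrow> cscale c (abs_L2 f) = abs_L2 (\<lambda>x. c * f x)"
  by (simp add: cscale.abs_eq L2_eq_refl)

lemma L_op_zero: "(0, 0) \<in> (L_op :: 'a::euclidean_space L2_operator)"
proof -
  have "neg_laplacian (\<lambda>x. 0 :: complex) = (\<lambda>x :: 'a. 0)"
    by (simp add: neg_laplacian_def partial_deriv_const fun_eq_iff)
  then show ?thesis
    using L_op_intro[OF C_c_infinity_zero[where 'a='a]] by (simp add: zero_L2_def)
qed

lemma L_op_add:
  assumes "(u, v) \<in> L_op" "(u', v') \<in> L_op"
  shows "(u + u', v + v') \<in> L_op"
proof -
  obtain f where f: "f \<in> C_c_infinity (UNIV - {0})" "u = abs_L2 f" "v = abs_L2 (neg_laplacian f)"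
    using assms(1) by (rule L_op_cases)
  obtain g where g: "g \<in> C_c_infinity (UNIV - {0})" "u' = abs_L2 g" "v' = abs_L2 (neg_laplacian g)"
    using assms(2) by (rule L_op_cases)
  show ?thesis
    using L_op_intro[OF C_c_infinity_add[OF f(1) g(1)]] f g
    by (simp add: abs_L2_add square_integrable_test_function neg_laplacian_add C_c_infinity_smooth)
qed

lemma L_op_cscale:
  assumes "(u, v) \<in> L_op"
  shows "(cscale c u, cscale c v) \<in> L_op"
proof -
  obtain f where f: "f \<in> C_c_infinity (UNIV - {0})" "u = abs_L2 f" "v = abs_L2 (neg_laplacian f)"
    using assms by (rule L_op_cases)
  show ?thesis
    using L_op_intro[OF C_c_infinity_mult[OF f(1) smooth_const[of c]]] f
    by (simp add: abs_L2_cscale square_integrable_test_function neg_laplacian_cmult C_c_infinity_smooth)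
qed

lemma cscale_add: "cscale c (u + v) = cscale c u + cscale c v"
  by transfer (auto simp: L2_eq_def distrib_left intro: square_integrable_cmult square_integrable_add)

lemma cinner_L_op:
  assumes f: "f \<in> C_c_infinity (UNIV - {0})" and g: "g \<in> C_c_infinity (UNIV - {0})"
  shows "cinner (abs_L2 (neg_laplacian f)) (abs_L2 g)
    = (\<Sum>b\<in>Basis. \<integral>x. partial_deriv b f x * cnj (partial_deriv b g x) \<partial>lborel)"
  using f g by (simp add: cinner_abs_L2 square_integrable_test_function Green_identity[OF f g])

text \<open>Both orthogonality conditions reduce to the separation of functions by test functions
  away from the origin. For the range condition, the weak equation is extended over the origin,
  which is where the dimension enters, and then solved.\<close>

theorem self_adjoint_closure_L_op:
  assumes dim: "DIM('a::euclidean_space) \<ge> 4"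
  shows "self_adjoint (op_closure (L_op :: 'a L2_operator))"
proof (rule self_adjoint_closure_of_nonneg)
  let ?L = "L_op :: 'a L2_operator"
  show "csubspace (Domain ?L)"
    unfolding csubspace_def using L_op_zero L_op_add L_op_cscale by blast
  show "csubspace {u + v | u v. (u, v) \<in> ?L}"
    unfolding csubspace_def
  proof (intro conjI ballI allI)
    show "0 \<in> {u + v | u v. (u, v) \<in> ?L}"
      using L_op_zero by force
    show "s + t \<in> {u + v | u v. (u, v) \<in> ?L}"
      if st: "s \<in> {u + v | u v. (u, v) \<in> ?L}" "t \<in> {u + v | u v. (u, v) \<in> ?L}" for s t
    proof -
      obtain u v u' v' where uv: "(u, v) \<in> ?L" "s = u + v" "(u', v') \<in> ?L" "t = u' + v'"
        using st by auto
      then have "s + t = (u + u') + (v + v')"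
        by simp
      then show ?thesis
        using L_op_add[OF uv(1,3)] by blast
    qed
    show "cscale c s \<in> {u + v | u v. (u, v) \<in> ?L}" if "s \<in> {u + v | u v. (u, v) \<in> ?L}" for c s
      using that L_op_cscale by (auto simp: cscale_add) blast
  qed
next
  fix u v u' v' :: "'a L2"
  assume "(u, v) \<in> L_op" "(u', v') \<in> L_op"
  then obtain f g where fg: "f \<in> C_c_infinity (UNIV - {0})" "g \<in> C_c_infinity (UNIV - {0})"
    "u = abs_L2 f" "v = abs_L2 (neg_laplacian f)" "u' = abs_L2 g" "v' = abs_L2 (neg_laplacian g)"
    by (elim L_op_cases) blast
  have "cinner u v' = cnj (cinner v' u)"
    by (rule cinner_commute)
  also have "\<dots> = cinner v u'"
    by (simp add: fg cinner_L_op mult.commute flip: Bochner_Integration.integral_cnj)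
  finally show "cinner v u' = cinner u v'"
    by simp
next
  fix u v :: "'a L2"
  assume "(u, v) \<in> L_op"
  then obtain f where "f \<in> C_c_infinity (UNIV - {0})" "u = abs_L2 f" "v = abs_L2 (neg_laplacian f)"
    by (rule L_op_cases)
  then show "0 \<le> Re (cinner v u)"
    by (simp add: cinner_L_op sum_nonneg flip: complex_norm_square of_real_power)
next
  fix w :: "'a L2"
  obtain h where h: "square_integrable h" "w = abs_L2 h"
    by (rule L2_cases)
  \<comment> \<open>The inner product conjugates its second argument, so the weak equation is
    satisfied by the conjugate of \<open>h\<close>.\<close>
  have ch: "square_integrable (\<lambda>x. cnj (h x))"
    using h(1) borel_measurable_mult_cnj[of "\<lambda>x. 1" lborel h] by (simp add: square_integrable_def)
  have sep: "w = 0" if "\<And>f. f \<in> C_c_infinity (UNIV - {0}) \<Longrightarrow> (\<integral>x. f x * cnj (h x) \<partial>lborel) = 0"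
    using test_functions_separating[OF local_L1_square_integrable[OF ch] that]
    by (simp add: h abs_L2_eq_0_iff)
  show "w = 0" if dom: "\<And>u. u \<in> Domain L_op \<Longrightarrow> cinner u w = 0"
  proof (rule sep)
    fix f :: "'a \<Rightarrow> complex"
    assume f: "f \<in> C_c_infinity (UNIV - {0})"
    have "cinner (abs_L2 f) w = 0"
      by (rule dom[OF DomainI[OF L_op_intro[OF f]]])
    then show "(\<integral>x. f x * cnj (h x) \<partial>lborel) = 0"
      using f h by (simp add: cinner_abs_L2 square_integrable_test_function)
  qed
  show "w = 0" if ran: "\<And>u v. (u, v) \<in> L_op \<Longrightarrow> cinner (u + v) w = 0"
  proof (rule sep)
    have weak: "(\<integral>x. (f x + neg_laplacian f x) * cnj (h x) \<partial>lborel) = 0"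
      if f: "f \<in> C_c_infinity (UNIV - {0})" for f
      using ran[OF L_op_intro[OF f]] f h
      by (simp add: abs_L2_add cinner_abs_L2 square_integrable_test_function square_integrable_add)
    have weak': "(\<integral>x. (f x + neg_laplacian f x) * cnj (h x) \<partial>lborel) = 0"
      if "f \<in> C_c_infinity UNIV" for f
      using weak that by (rule weak_equation_extends_over_origin[OF dim ch])
    fix f :: "'a \<Rightarrow> complex"
    assume "f \<in> C_c_infinity (UNIV - {0})"
    then show "(\<integral>x. f x * cnj (h x) \<partial>lborel) = 0"
      by (intro weak_solution_eq_0[OF ch weak']) (auto dest: C_c_infinity_UNIV)
  qed
qed

theorem mainTheorem6:
  assumes "CARD('d::finite) \<ge> 4"
  shows "self_adjoint (op_closure (L_op :: (real ^ 'd) L2_operator))"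
  using assms by (intro self_adjoint_closure_L_op) simp

end
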